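(* Let $k$ be an algebraically closed field of characteristic zero, $R=k[x_1,\dots,x_n]$, $\mathbf{m}=\langle x_1,\dots,x_n\rangle$, and let $I$ be a monomial ideal of $R$ with $\dim_k(R/I)<\infty$. Let $M=R/I$, regarded as an $R$-module, and let $\mathfrak{R}(M)^\vee=I^\perp/(\mathbf{m}\circ I^\perp)$. Then: 1. For a set $A\subseteq\mathbb{Z}_{\ge 0}^n$ of exponent vectors, the submodule $\mathfrak{R}(M)$ of $M$ is generated by the monomials $x_1^{a_1}\cdots x_n^{a_n}$ mod $I$, $(a_1,\dots,a_n)\in A$, if and only if the quotient $\mathfrak{R}(M)^\vee$ of $I^\perp$ is generated by the monomials $X_1^{a_1}\cdots X_n^{a_n}$ mod $\mathbf{m}\circ I^\perp$, $(a_1,\dots,a_n)\in A$. 2. $HS(\mathfrak{R}(M),t)=HS(\mathfrak{R}(M)^\vee,t)$. 3. $\mathfrak{R}(M)^\vee$ is the largest reduced quotient of $I^\perp$; that is, $I^\perp/(\mathbf{m}\circ I^\perp)$ is a reduced $R$-module, and every submodule $N\subseteq I^\perp$ with $I^\perp/N$ reduced contains $\mathbf{m}\circ I^\perp$.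
   Context: Let $\Gamma=k[X_1,\dots,X_n]$ be the $R$-module with the apolarity action, the $k$-bilinear action determined by $x^\alpha\circ X^\beta=\frac{\beta!}{(\beta-\alpha)!}X^{\beta-\alpha}$ if $\beta_j\ge\alpha_j$ for all $j$, and $0$ otherwise. $I^\perp=\{\gamma\in\Gamma: I\circ\gamma=0\}$ is the Macaulay inverse system of $I$, an $R$-submodule of $\Gamma$, and $\mathbf{m}\circ I^\perp$ is the submodule of $I^\perp$ generated by all $a\circ\gamma$ with $a\in\mathbf{m}$, $\gamma\in I^\perp$. An $R$-module $N$ is reduced if for all $a\in R$, $m\in N$, $a^2m=0$ implies $am=0$. For an $R$-module $N$, $\mathfrak{R}(N)=\{m\in N:\text{for all }a\in R,\ a^2m=0\Rightarrow am=0\}$; for $M=R/I$ as in the claim this is a submodule of $M$. Its Macaulay (Matlis) dual $\mathfrak{R}(M)^\vee$ is the quotient $I^\perp/(\mathbf{m}\circ I^\perp)$ of $I^\perp$. Convention for assertion 1: "generated by" a family of monomials refers to the monomial basis as a $k$-vector space, i.e. the left-hand condition means that the family $(x^a \bmod I)_{a\in A}$ is a $k$-basis of $\mathfrak{R}(M)$, and the right-hand condition means that $X^a\in I^\perp$ for all $a\in A$ and the family $(X^a \bmod \mathbf{m}\circ I^\perp)_{a\in A}$ is a $k$-basis of $\mathfrak{R}(M)^\vee$. For a graded $k$-vector space $N=\bigoplus_{d\in\mathbb{N}}N_d$ with finite-dimensional pieces, $HS(N,t)=\sum_{d\in\mathbb{N}}(\dim_kN_d)t^d$. Here $\mathfrak{R}(M)$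 is graded as a subspace of $R/I$ (with $x^a$ in degree $a_1+\dots+a_n$), and $\mathfrak{R}(M)^\vee$ is graded as a quotient of $I^\perp\subseteq\Gamma$ (with $X^a$ in degree $a_1+\dots+a_n$). *)

theory Defs
  imports
    "HOL-Library.Poly_Mapping"
    "HOL-Algebra.QuotRing"
    "HOL-Computational_Algebra.Formal_Power_Series"
    "Jordan_Normal_Form.VS_Connect"
begin

hide_const (open) Multiset.mult Polynomial.smult Modules.module

text \<open>Modules are \<open>HOL-Algebra\<close> records.  These records also carry the fields
  \<^const>\<open>mult\<close> and \<^const>\<open>one\<close>, which play no role for a module.\<close>

definition quot_module :: "('a, 'b) module \<Rightarrow> 'b set \<Rightarrow> ('a, 'b set) module"
  where "quot_module M N =
    \<lparr>carrier = a_rcosets\<^bsub>M\<^esub> N, mult = undefined, one = undefined,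
     zero = N, add = set_add M,
     smult = (\<lambda>a C. \<Union>m\<in>C. N +>\<^bsub>M\<^esub> (a \<odot>\<^bsub>M\<^esub> m))\<rparr>"

definition reduced_module :: "('a, 'm) ring_scheme \<Rightarrow> ('a, 'b) module \<Rightarrow> bool"
  where "reduced_module R N \<longleftrightarrow>
    (\<forall>a\<in>carrier R. \<forall>m\<in>carrier N.
       (a [^]\<^bsub>R\<^esub> (2::nat)) \<odot>\<^bsub>N\<^esub> m = \<zero>\<^bsub>N\<^esub> \<longrightarrow> a \<odot>\<^bsub>N\<^esub> m = \<zero>\<^bsub>N\<^esub>)"

definition reduced_part :: "('a, 'm) ring_scheme \<Rightarrow> ('a, 'b) module \<Rightarrow> 'b set"
  where "reduced_part R N =
    {m \<in> carrier N. \<forall>a\<in>carrier R.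
       (a [^]\<^bsub>R\<^esub> (2::nat)) \<odot>\<^bsub>N\<^esub> m = \<zero>\<^bsub>N\<^esub> \<longrightarrow> a \<odot>\<^bsub>N\<^esub> m = \<zero>\<^bsub>N\<^esub>}"

text \<open>Basis of a vector space over the field type \<open>'k\<close>, for families; the family has to
  be injective, since \<^const>\<open>vectorspace.basis\<close> speaks about sets.\<close>

definition basis_family :: "('k::field, 'b) module \<Rightarrow> 'i set \<Rightarrow> ('i \<Rightarrow> 'b) \<Rightarrow> bool"
  where "basis_family V A f \<longleftrightarrow>
    inj_on f A \<and> vectorspace.basis (class_ring :: 'k ring) V (f ` A)"

text \<open>\<open>W d\<close> is the subspace of \<open>V\<close> of degree \<open>d\<close>.\<close>

definition hilbert_series :: "('k::field, 'b) module \<Rightarrow> (nat \<Rightarrow> 'b set) \<Rightarrow> nat fps"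
  where "hilbert_series V W =
    Abs_fps (\<lambda>d. vectorspace.dim (class_ring :: 'k ring) (V\<lparr>carrier := W d\<rparr>))"

text \<open>The variables are indexed by a finite type \<open>'n\<close>, and the exponent vectors are the
  elements of \<open>'n \<Rightarrow>\<^sub>0 nat\<close>.  The same type serves for \<open>k[x\<^sub>1,\<dots>,x\<^sub>n]\<close> and for
  \<open>k[X\<^sub>1,\<dots>,X\<^sub>n]\<close>.\<close>

type_synonym ('n, 'k) mpoly = "('n \<Rightarrow>\<^sub>0 nat) \<Rightarrow>\<^sub>0 'k"

abbreviation poly_ring :: "('n::finite, 'k::field) mpoly ring"
  where "poly_ring \<equiv> class_ring"

definition power_product :: "('n::finite \<Rightarrow>\<^sub>0 nat) \<Rightarrow> ('n, 'k::field) mpoly"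
  where "power_product \<alpha> = Poly_Mapping.single \<alpha> 1"

definition var :: "'n::finite \<Rightarrow> ('n, 'k::field) mpoly"
  where "var i = power_product (Poly_Mapping.single i 1)"

definition const_poly :: "'k::field \<Rightarrow> ('n::finite, 'k) mpoly"
  where "const_poly c = Poly_Mapping.single 0 c"

definition homogeneous :: "nat \<Rightarrow> ('n::finite, 'k::field) mpoly set"
  where "homogeneous d =
    {p. \<forall>\<alpha>\<in>Poly_Mapping.keys p. (\<Sum>i\<in>UNIV. Poly_Mapping.lookup \<alpha> i) = d}"

definition max_ideal :: "('n::finite, 'k::field) mpoly set"
  where "max_ideal = Idl\<^bsub>poly_ring\<^esub> (range var)"

definition monomial_ideal :: "('n::finite, 'k::field) mpoly set \<Rightarrow> bool"
  where "monomial_ideal I \<longleftrightarrow> (\<exists>S. I = Idl\<^bsub>poly_ring\<^esub> (power_product ` S))"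

text \<open>The underlying \<open>k\<close>-vector space, by restriction of scalars along \<open>k \<rightarrow> R\<close>.\<close>

definition k_space :: "(('n::finite, 'k::field) mpoly, 'b) module \<Rightarrow> ('k, 'b) module"
  where "k_space M =
    \<lparr>carrier = carrier M, mult = mult M, one = one M, zero = zero M, add = add M,
     smult = (\<lambda>c m. const_poly c \<odot>\<^bsub>M\<^esub> m)\<rparr>"

definition regular_module :: "(('n::finite, 'k::field) mpoly, ('n, 'k) mpoly) module"
  where "regular_module =
    \<lparr>carrier = UNIV, mult = undefined, one = undefined, zero = 0, add = (+), smult = (*)\<rparr>"

definition ideal_quotient ::
    "('n::finite, 'k::field) mpoly set \<Rightarrow> (('n, 'k) mpoly, ('n, 'k) mpoly set) module"
  where "ideal_quotient I = quot_module regular_module I"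

definition mod_ideal :: "('n::finite, 'k::field) mpoly set \<Rightarrow> ('n, 'k) mpoly \<Rightarrow> ('n, 'k) mpoly set"
  where "mod_ideal I p = I +>\<^bsub>regular_module\<^esub> p"

definition reduced_quotient_part :: "('n::finite, 'k::field) mpoly set \<Rightarrow> ('n, 'k) mpoly set set"
  where "reduced_quotient_part I = reduced_part poly_ring (ideal_quotient I)"

definition reduced_part_space ::
    "('n::finite, 'k::field) mpoly set \<Rightarrow> ('k, ('n, 'k) mpoly set) module"
  where "reduced_part_space I =
    (k_space (ideal_quotient I))\<lparr>carrier := reduced_quotient_part I\<rparr>"

definition reduced_part_grading ::
    "('n::finite, 'k::field) mpoly set \<Rightarrow> nat \<Rightarrow> ('n, 'k) mpoly set set"
  where "reduced_part_grading I d = reduced_quotient_part I \<inter> mod_ideal I ` homogeneous d"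

definition apolar_mono ::
    "('n::finite \<Rightarrow>\<^sub>0 nat) \<Rightarrow> ('n \<Rightarrow>\<^sub>0 nat) \<Rightarrow> ('n, 'k::field_char_0) mpoly"
  where "apolar_mono \<alpha> \<beta> =
    (if \<forall>j. Poly_Mapping.lookup \<alpha> j \<le> Poly_Mapping.lookup \<beta> j
     then Poly_Mapping.single (\<beta> - \<alpha>)
       ((\<Prod>j\<in>UNIV. fact (Poly_Mapping.lookup \<beta> j)) /
        (\<Prod>j\<in>UNIV. fact (Poly_Mapping.lookup (\<beta> - \<alpha>) j)))
     else 0)"

definition apolar ::
    "('n::finite, 'k::field_char_0) mpoly \<Rightarrow> ('n, 'k) mpoly \<Rightarrow> ('n, 'k) mpoly"
  where "apolar a \<gamma> =
    (\<Sum>\<alpha>\<in>Poly_Mapping.keys a. \<Sum>\<beta>\<in>Poly_Mapping.keys \<gamma>.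
       const_poly (Poly_Mapping.lookup a \<alpha> * Poly_Mapping.lookup \<gamma> \<beta>) * apolar_mono \<alpha> \<beta>)"

definition apolar_module :: "(('n::finite, 'k::field_char_0) mpoly, ('n, 'k) mpoly) module"
  where "apolar_module =
    \<lparr>carrier = UNIV, mult = undefined, one = undefined, zero = 0, add = (+), smult = apolar\<rparr>"

definition inverse_system :: "('n::finite, 'k::field_char_0) mpoly set \<Rightarrow> ('n, 'k) mpoly set"
  where "inverse_system I = {\<gamma>. \<forall>a\<in>I. apolar a \<gamma> = 0}"

definition inverse_system_module ::
    "('n::finite, 'k::field_char_0) mpoly set \<Rightarrow> (('n, 'k) mpoly, ('n, 'k) mpoly) module"
  where "inverse_system_module I = apolar_module\<lparr>carrier := inverse_system I\<rparr>"

definition max_apolar :: "('n::finite, 'k::field_char_0) mpoly set \<Rightarrow> ('n, 'k) mpoly set"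
  where "max_apolar I =
    module.span poly_ring (inverse_system_module I)
      {apolar a \<gamma> | a \<gamma>. a \<in> max_ideal \<and> \<gamma> \<in> inverse_system I}"

definition dual_module ::
    "('n::finite, 'k::field_char_0) mpoly set \<Rightarrow> (('n, 'k) mpoly, ('n, 'k) mpoly set) module"
  where "dual_module I = quot_module (inverse_system_module I) (max_apolar I)"

definition mod_max_apolar ::
    "('n::finite, 'k::field_char_0) mpoly set \<Rightarrow> ('n, 'k) mpoly \<Rightarrow> ('n, 'k) mpoly set"
  where "mod_max_apolar I \<gamma> = max_apolar I +>\<^bsub>inverse_system_module I\<^esub> \<gamma>"

definition dual_grading ::
    "('n::finite, 'k::field_char_0) mpoly set \<Rightarrow> nat \<Rightarrow> ('n, 'k) mpoly set set"
  where "dual_grading I d = mod_max_apolar I ` (inverse_system I \<inter> homogeneous d)"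

end

theory Submission
  imports Defs
begin

text \<open>Let \<open>S\<close> be the finite set of exponents \<open>\<alpha>\<close> with \<open>x\<^sup>\<alpha> \<notin> I\<close> and \<open>T\<close> the set of its maximal
  elements, those \<open>\<alpha>\<close> for which every \<open>\<alpha> + e\<^sub>i\<close> lies outside \<open>S\<close>.  Since \<open>R/I\<close> is
  finite-dimensional, each variable acts nilpotently on \<open>R/I\<close> and on \<open>I\<^sup>\<bottom>\<close>.  Under nilpotent
  variables, \<open>a\<^sup>2m = 0 \<Longrightarrow> am = 0\<close> for all \<open>a\<close> holds exactly when the variables kill \<open>m\<close>.  Hence
  \<open>\<RR>(R/I)\<close> is the socle of \<open>R/I\<close>, with basis \<open>x\<^sup>\<alpha>\<close> for \<open>\<alpha> \<in> T\<close>, and a quotient of \<open>I\<^sup>\<bottom>\<close> is reduced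
  exactly when its kernel contains \<open>\<mm> \<circ> I\<^sup>\<bottom>\<close>.  Here \<open>I\<^sup>\<bottom>\<close> is spanned by the \<open>X\<^sup>\<alpha>\<close> with
  \<open>\<alpha> \<in> S\<close> and \<open>\<mm> \<circ> I\<^sup>\<bottom>\<close> by those with \<open>\<alpha> \<in> S - T\<close>, so the dual has the basis \<open>X\<^sup>\<alpha>\<close> for
  \<open>\<alpha> \<in> T\<close>, too.\<close>

section \<open>Polynomials with prescribed support\<close>

text \<open>The k-span of the monomials with exponent in B. \<open>I\<close>,
  \<open>inverse_system I\<close>, \<open>max_apolar I\<close> and the homogeneous parts all turn
  out to have this form, which reduces inclusions, intersections and quotients to set operations on
  exponents.\<close>

definition supported :: "('n::finite \<Rightarrow>\<^sub>0 nat) set \<Rightarrow> ('n, 'k::field) mpoly set"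
  where "supported B = {p. Poly_Mapping.keys p \<subseteq> B}"

text \<open>Formed with the addition of the type rather than that of a record, so that one notion
  serves the cosets in all the modules below; \<open>r_coset_eq\<close> makes the link.\<close>

definition coset :: "'a::ab_group_add set \<Rightarrow> 'a \<Rightarrow> 'a set"
  where "coset N p = (\<lambda>h. h + p) ` N"

lemma lookup_const_poly_mult [simp]:
  "Poly_Mapping.lookup (const_poly c * p) \<alpha> = c * Poly_Mapping.lookup p \<alpha>"
  by (simp add: const_poly_def mult_map_scale_conv_mult[symmetric] Poly_Mapping.map.rep_eq when_def)

lemma const_poly_simps [simp]:
  "const_poly 0 = 0" "const_poly 1 = 1"
  "const_poly (c + d) = const_poly c + const_poly d"
  "const_poly (c * d) = const_poly c * const_poly d"
  by (simp_all add: const_poly_def single_add mult_single)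

lemma const_poly_mult_single: "const_poly c * Poly_Mapping.single \<alpha> d = Poly_Mapping.single \<alpha> (c * d)"
  by (simp add: const_poly_def mult_single)

lemma mpoly_eq_sum_singles:
  fixes p :: "('n::finite, 'k::field) mpoly"
  shows "p = (\<Sum>\<alpha>\<in>Poly_Mapping.keys p. Poly_Mapping.single \<alpha> (Poly_Mapping.lookup p \<alpha>))"
  by (rule poly_mapping_eqI)
    (auto simp: lookup_sum lookup_single when_def in_keys_iff)

text \<open>In contrast to \<open>mpoly_induct\<close>, only the terms that occur in p itself have
  to lie in P, so a condition on the support of p can be used when they are checked.\<close>

lemma mpoly_sum_mem:
  fixes p :: "('n::finite, 'k::field) mpoly"
  assumes "0 \<in> P" and "\<And>p q. p \<in> P \<Longrightarrow> q \<in> P \<Longrightarrow> p + q \<in> P"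
    and "\<And>\<alpha>. \<alpha> \<in> Poly_Mapping.keys p \<Longrightarrow>
           Poly_Mapping.single \<alpha> (Poly_Mapping.lookup p \<alpha>) \<in> P"
  shows "p \<in> P"
proof -
  have "(\<Sum>\<alpha>\<in>F. Poly_Mapping.single \<alpha> (Poly_Mapping.lookup p \<alpha>)) \<in> P"
    if "finite F" "F \<subseteq> Poly_Mapping.keys p" for F
    using that by (induction F rule: finite_induct) (use assms in auto)
  then show ?thesis
    by (subst mpoly_eq_sum_singles) simp
qed

lemma mpoly_induct [case_names zero single add]:
  fixes p :: "('n::finite, 'k::field) mpoly"
  assumes "P 0" and "\<And>\<alpha> c. P (Poly_Mapping.single \<alpha> c)"
    and "\<And>p q. P p \<Longrightarrow> P q \<Longrightarrow> P (p + q)"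
  shows "P p"
  using mpoly_sum_mem[of "Collect P" p] assms by auto

lemma supportedI: "(\<And>\<alpha>. \<alpha> \<notin> B \<Longrightarrow> Poly_Mapping.lookup p \<alpha> = 0) \<Longrightarrow> p \<in> supported B"
  by (auto simp: supported_def in_keys_iff)

lemma supportedD: "p \<in> supported B \<Longrightarrow> \<alpha> \<notin> B \<Longrightarrow> Poly_Mapping.lookup p \<alpha> = 0"
  by (auto simp: supported_def in_keys_iff)

lemma supported_zero [simp]: "0 \<in> supported B"
  by (simp add: supported_def)

lemma supported_add: "p \<in> supported B \<Longrightarrow> q \<in> supported B \<Longrightarrow> p + q \<in> supported B"
  by (rule supportedI) (simp add: lookup_add supportedD)

lemma supported_minus: "p \<in> supported B \<Longrightarrow> q \<in> supported B \<Longrightarrow> p - q \<in> supported B"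
  by (rule supportedI) (simp add: lookup_minus supportedD)

lemma supported_const_poly_mult: "p \<in> supported B \<Longrightarrow> const_poly c * p \<in> supported B"
  by (rule supportedI) (simp add: supportedD)

lemma single_mem_supported: "Poly_Mapping.single \<alpha> c \<in> supported B \<longleftrightarrow> c = 0 \<or> \<alpha> \<in> B"
  by (auto simp: supported_def)

lemma power_product_mem_supported: "power_product \<alpha> \<in> supported B \<longleftrightarrow> \<alpha> \<in> B"
  by (simp add: power_product_def single_mem_supported)

lemma supported_mono: "B \<subseteq> C \<Longrightarrow> supported B \<subseteq> supported C"
  by (auto simp: supported_def)

lemma supported_Int: "supported B \<inter> supported C = supported (B \<inter> C)"
  by (auto simp: supported_def)

lemma supported_disjoint: "p \<in> supported B \<Longrightarrow> p \<in> supported C \<Longrightarrow> B \<inter> C = {} \<Longrightarrow> p = 0"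
  unfolding supported_def using keys_eq_empty by blast

lemma homogeneous_eq_supported:
  "homogeneous d = supported {\<alpha>. (\<Sum>i\<in>UNIV. Poly_Mapping.lookup \<alpha> i) = d}"
  by (auto simp: homogeneous_def supported_def)

text \<open>B and C may overlap: terms with exponent in B go into q, the remaining ones into
  r.\<close>

lemma supported_Un_decompose:
  assumes "p \<in> supported (B \<union> C)"
  obtains q r where "q \<in> supported B" "r \<in> supported C" "p = r + q"
proof -
  have "p \<in> {r + q |q r. q \<in> supported B \<and> r \<in> supported C}" (is "_ \<in> ?P")
  proof (rule mpoly_sum_mem)
    show "0 \<in> ?P" by (auto intro!: exI[of _ 0])
    show "x + y \<in> ?P" if xy: "x \<in> ?P" "y \<in> ?P" for x y
    proof -
      obtain q r q' r' where *: "x = r + q" "y = r' + q'" "q \<in> supported B" "q' \<in> supported B"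
        "r \<in> supported C" "r' \<in> supported C"
        using xy by auto
      then have "x + y = (r + r') + (q + q')" by simp
      then show ?thesis using * supported_add by blast
    qed
    show "Poly_Mapping.single \<alpha> (Poly_Mapping.lookup p \<alpha>) \<in> ?P" if "\<alpha> \<in> Poly_Mapping.keys p" for \<alpha>
    proof (cases "\<alpha> \<in> B")
      case True
      then show ?thesis
        by (intro CollectI exI[of _ "Poly_Mapping.single \<alpha> (Poly_Mapping.lookup p \<alpha>)"] exI[of _ 0])
          (simp add: single_mem_supported)
    next
      case False
      then have "\<alpha> \<in> C" using that assms by (auto simp: supported_def)
      then show ?thesis
        by (intro CollectI exI[of _ "Poly_Mapping.single \<alpha> (Poly_Mapping.lookup p \<alpha>)"] exI[of _ 0])
          (simp add: single_mem_supported)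
    qed
  qed
  then show ?thesis using that by blast
qed

section \<open>Spaces with a monomial basis\<close>

text \<open>\<open>\<phi>\<close> is a linear bijection from \<open>supported B\<close> onto V. The
  vector space laws of V are not assumed but transported along \<open>\<phi>\<close>. The locale
  serves R/I, its reduced part, the dual, and the graded pieces of the last two.\<close>

locale coordinate_space =
  fixes V :: "('k::field, 'b) module" and B :: "('n::finite \<Rightarrow>\<^sub>0 nat) set"
    and \<phi> :: "('n, 'k) mpoly \<Rightarrow> 'b"
  assumes carrier_eq: "carrier V = \<phi> ` supported B"
    and hom_zero: "\<phi> 0 = \<zero>\<^bsub>V\<^esub>"
    and hom_add: "\<And>p q. p \<in> supported B \<Longrightarrow> q \<in> supported B \<Longrightarrow> \<phi> (p + q) = \<phi> p \<oplus>\<^bsub>V\<^esub> \<phi> q"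
    and hom_smult: "\<And>c p. p \<in> supported B \<Longrightarrow> \<phi> (const_poly c * p) = c \<odot>\<^bsub>V\<^esub> \<phi> p"
    and inj: "inj_on \<phi> (supported B)"
begin

lemma vectorspace_V: "vectorspace (class_ring :: 'k ring) V"
proof (rule vs_criteria)
  show "\<forall>v\<in>carrier V. \<exists>w\<in>carrier V. v \<oplus>\<^bsub>V\<^esub> w = \<zero>\<^bsub>V\<^esub>"
  proof
    fix v assume "v \<in> carrier V"
    then obtain p where p: "v = \<phi> p" "p \<in> supported B" by (auto simp: carrier_eq)
    have "v \<oplus>\<^bsub>V\<^esub> \<phi> (0 - p) = \<zero>\<^bsub>V\<^esub>" "0 - p \<in> supported B"
      using p hom_add[of p "0 - p"] hom_zero supported_minus[of 0 B p] by simp_all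
    then show "\<exists>w\<in>carrier V. v \<oplus>\<^bsub>V\<^esub> w = \<zero>\<^bsub>V\<^esub>" by (auto simp: carrier_eq)
  qed
qed (auto simp: carrier_eq class_field hom_zero[symmetric] hom_add[symmetric] hom_smult[symmetric]
    supported_add supported_const_poly_mult distrib_left distrib_right add_ac
    mult.assoc)

sublocale vectorspace "class_ring :: 'k ring" V
  by (rule vectorspace_V)

text \<open>The right side is a subspace containing the generators; conversely each of its elements
  is the image of a sum of scaled monomials.\<close>

lemma span_power_products:
  assumes "F \<subseteq> B"
  shows "span ((\<lambda>a. \<phi> (power_product a)) ` F) = \<phi> ` supported F"
proof
  have FB: "supported F \<subseteq> supported B" by (rule supported_mono[OF assms])
  have sub: "(\<lambda>a. \<phi> (power_product a)) ` F \<subseteq> carrier V"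
    using assms by (auto simp: carrier_eq power_product_mem_supported)
  have "LinearCombinations.submodule class_ring (\<phi> ` supported F) V"
  proof
    fix v w assume "v \<in> \<phi> ` supported F" "w \<in> \<phi> ` supported F"
    then obtain p q where "v = \<phi> p" "w = \<phi> q" "p \<in> supported F" "q \<in> supported F" by auto
    moreover from this FB have "\<phi> p \<oplus>\<^bsub>V\<^esub> \<phi> q = \<phi> (p + q)"
      by (intro hom_add[symmetric]) auto
    ultimately show "v \<oplus>\<^bsub>V\<^esub> w \<in> \<phi> ` supported F"
      by (auto intro: supported_add)
  next
    show "\<zero>\<^bsub>V\<^esub> \<in> \<phi> ` supported F"
      unfolding hom_zero[symmetric] by (rule imageI) simp
  next
    fix c v assume "v \<in> \<phi> ` supported F"
    then obtain p where "v = \<phi> p" "p \<in> supported F" by auto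
    with FB show "c \<odot>\<^bsub>V\<^esub> v \<in> \<phi> ` supported F"
      by (intro image_eqI[of _ _ "const_poly c * p"])
        (auto simp: hom_smult supported_const_poly_mult dest: subsetD)
  qed (use FB in \<open>auto simp: carrier_eq\<close>)
  then show "span ((\<lambda>a. \<phi> (power_product a)) ` F) \<subseteq> \<phi> ` supported F"
    by (rule span_is_subset[rotated]) (auto simp: power_product_mem_supported)
  interpret S: LinearCombinations.submodule class_ring "span ((\<lambda>a. \<phi> (power_product a)) ` F)" V
    by (rule span_is_submodule[OF sub])
  show "\<phi> ` supported F \<subseteq> span ((\<lambda>a. \<phi> (power_product a)) ` F)"
  proof
    fix v assume "v \<in> \<phi> ` supported F"
    then obtain p where p: "v = \<phi> p" "p \<in> supported F" by auto
    have "p \<in> {p \<in> supported B. \<phi> p \<in> span ((\<lambda>a. \<phi> (power_product a)) ` F)}"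
    proof (rule mpoly_sum_mem)
      fix \<alpha> assume "\<alpha> \<in> Poly_Mapping.keys p"
      then have \<alpha>: "\<alpha> \<in> F" using p by (auto simp: supported_def)
      then have \<alpha>B: "\<alpha> \<in> B" using assms by auto
      have "\<phi> (power_product \<alpha>) \<in> span ((\<lambda>a. \<phi> (power_product a)) ` F)"
        using span_mem[OF sub] \<alpha> by blast
      then have "Poly_Mapping.lookup p \<alpha> \<odot>\<^bsub>V\<^esub> \<phi> (power_product \<alpha>)
          \<in> span ((\<lambda>a. \<phi> (power_product a)) ` F)"
        by simp
      also have "Poly_Mapping.lookup p \<alpha> \<odot>\<^bsub>V\<^esub> \<phi> (power_product \<alpha>) =
          \<phi> (Poly_Mapping.single \<alpha> (Poly_Mapping.lookup p \<alpha>))"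
        using \<alpha>B by (simp add: hom_smult[symmetric] power_product_mem_supported)
          (simp add: power_product_def const_poly_mult_single)
      finally show "Poly_Mapping.single \<alpha> (Poly_Mapping.lookup p \<alpha>)
          \<in> {p \<in> supported B. \<phi> p \<in> span ((\<lambda>a. \<phi> (power_product a)) ` F)}"
        using \<alpha>B by (simp add: single_mem_supported)
    qed (use hom_zero in \<open>auto simp: supported_add hom_add\<close>)
    then show "v \<in> span ((\<lambda>a. \<phi> (power_product a)) ` F)" using p by simp
  qed
qed

lemma inj_on_power_products: "inj_on (\<lambda>a. \<phi> (power_product a)) B"
proof (rule inj_onI)
  fix a b assume "a \<in> B" "b \<in> B" "\<phi> (power_product a) = \<phi> (power_product b)"
  then have "(power_product a :: ('n, 'k) mpoly) = power_product b"
    by (auto intro: inj_onD[OF inj] simp: power_product_mem_supported)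
  then have "Poly_Mapping.keys (power_product a :: ('n, 'k) mpoly) = Poly_Mapping.keys (power_product b :: ('n, 'k) mpoly)"
    by simp
  then show "a = b" by (simp add: power_product_def)
qed

text \<open>In a dependent family some member lies in the span of the others, the image of
  \<open>supported (F - {a})\<close>. Injectivity of \<open>\<phi>\<close> would then place the
  monomial of a itself in \<open>supported (F - {a})\<close>.\<close>

lemma power_products_lin_indpt:
  assumes "F \<subseteq> B" "finite F"
  shows "lin_indpt ((\<lambda>a. \<phi> (power_product a)) ` F)"
proof
  assume "lin_dep ((\<lambda>a. \<phi> (power_product a)) ` F)"
  moreover have "(\<lambda>a. \<phi> (power_product a)) ` F \<subseteq> carrier V"
    using assms by (auto simp: carrier_eq power_product_mem_supported)
  ultimately obtain a where a: "a \<in> F"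
    "\<phi> (power_product a) \<in> span ((\<lambda>a. \<phi> (power_product a)) ` F - {\<phi> (power_product a)})"
    using lindep_span assms by auto
  have "(\<lambda>a. \<phi> (power_product a)) ` F - {\<phi> (power_product a)} = (\<lambda>a. \<phi> (power_product a)) ` (F - {a})"
    using inj_on_image_set_diff[OF inj_on_power_products, of F "{a}"] assms a by auto
  then have "\<phi> (power_product a) \<in> \<phi> ` supported (F - {a})"
    using a span_power_products[of "F - {a}"] assms by auto
  then have "power_product a \<in> (supported (F - {a}) :: ('n, 'k) mpoly set)"
    using assms a supported_mono[of "F - {a}" B]
    by (subst (asm) inj_on_image_mem_iff[OF inj]) (auto simp: power_product_mem_supported)
  then show False by (simp add: power_product_mem_supported)
qed

lemma basis_power_products:
  assumes "finite B"
  shows "basis ((\<lambda>a. \<phi> (power_product a)) ` B)"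
  unfolding basis_def
proof (intro conjI)
  show "lin_indpt ((\<lambda>a. \<phi> (power_product a)) ` B)"
    using assms by (intro power_products_lin_indpt) simp_all
  show "span ((\<lambda>a. \<phi> (power_product a)) ` B) = carrier V"
    by (simp add: span_power_products carrier_eq)
qed (auto simp: carrier_eq power_product_mem_supported)

lemma dim_eq_card:
  assumes "finite B"
  shows "dim = card B"
  using dim_basis[OF _ basis_power_products] assms card_image[OF inj_on_power_products] by simp

text \<open>Every finite subset of B yields an independent family, so its size is at most
  \<open>dim\<close>; a set whose finite subsets have bounded size is finite.\<close>

lemma finite_if_fin_dim:
  assumes "fin_dim"
  shows "finite B"
proof (rule finite_if_finite_subsets_card_bdd[THEN conjunct1])
  fix F assume F: "F \<subseteq> B" "finite F"
  then have "card ((\<lambda>a. \<phi> (power_product a)) ` F) \<le> dim"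
    by (intro li_le_dim[OF assms] power_products_lin_indpt)
      (auto simp: carrier_eq power_product_mem_supported)
  then show "card F \<le> dim"
    using card_image[OF inj_on_subset[OF inj_on_power_products F(1)]] by simp
qed

text \<open>An independent family avoids zero, so the second assumption forces A into B. Then A and
  B have spans with equal preimages under the injective \<open>\<phi>\<close>, whence A = B.\<close>

lemma basis_family_iff:
  assumes "finite B" and "\<And>a. a \<in> A - B \<Longrightarrow> \<phi> (power_product a) \<in> carrier V \<Longrightarrow> \<phi> (power_product a) = \<zero>\<^bsub>V\<^esub>"
  shows "basis_family V A (\<lambda>a. \<phi> (power_product a)) \<longleftrightarrow> A = B"
proof
  assume "basis_family V A (\<lambda>a. \<phi> (power_product a))"
  then have b: "lin_indpt ((\<lambda>a. \<phi> (power_product a)) ` A)"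
    "span ((\<lambda>a. \<phi> (power_product a)) ` A) = carrier V"
    "(\<lambda>a. \<phi> (power_product a)) ` A \<subseteq> carrier V"
    unfolding basis_family_def basis_def by blast+
  have "\<zero>\<^bsub>V\<^esub> \<notin> (\<lambda>a. \<phi> (power_product a)) ` A"
  proof (rule zero_nin_lin_indpt[OF b(3,1)])
    show "carrier (class_ring :: 'k ring) \<noteq> {\<zero>\<^bsub>class_ring\<^esub>}"
    proof
      assume "carrier (class_ring :: 'k ring) = {\<zero>\<^bsub>class_ring\<^esub>}"
      moreover have "(1 :: 'k) \<in> carrier class_ring" by simp
      ultimately have "(1 :: 'k) \<in> {\<zero>\<^bsub>class_ring\<^esub>}" by (rule subst)
      then show False by simp
    qed
  qed
  then have AB: "A \<subseteq> B"
    using assms(2) b(3) by (metis DiffI image_subset_iff rev_image_eqI subsetI)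
  then have "\<phi> ` supported A = \<phi> ` supported B"
    using span_power_products b carrier_eq by simp
  then have "supported A = (supported B :: ('n, 'k) mpoly set)"
    using inj_on_image_eq_iff[OF inj] supported_mono[OF AB] by blast
  then show "A = B"
    by (metis power_product_mem_supported subset_antisym subsetI)
next
  assume "A = B"
  then show "basis_family V A (\<lambda>a. \<phi> (power_product a))"
    unfolding basis_family_def using basis_power_products[OF assms(1)] inj_on_power_products
    by blast
qed

end


section \<open>Cosets and quotients of spaces with prescribed support\<close>

lemma coset_eq_iff:
  fixes N :: "'a::ab_group_add set"
  assumes "0 \<in> N" and "\<And>x y. x \<in> N \<Longrightarrow> y \<in> N \<Longrightarrow> x + y \<in> N" and "\<And>x y. x \<in> N \<Longrightarrow> y \<in> N \<Longrightarrow> x - y \<in> N"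
  shows "coset N p = coset N q \<longleftrightarrow> p - q \<in> N"
proof
  assume "coset N p = coset N q"
  moreover have "p \<in> coset N p" using assms(1) by (force simp: coset_def)
  ultimately show "p - q \<in> N" by (auto simp: coset_def)
next
  assume pq: "p - q \<in> N"
  have "h + p \<in> coset N q" if "h \<in> N" for h
    unfolding coset_def using assms(2)[OF that pq] by (intro image_eqI[of _ _ "h + (p - q)"]) simp_all
  moreover have "h + q \<in> coset N p" if "h \<in> N" for h
    unfolding coset_def using assms(3)[OF that pq] by (intro image_eqI[of _ _ "h - (p - q)"]) simp_all
  ultimately show "coset N p = coset N q" by (auto simp: coset_def)
qed

lemma coset_supported_eq_iff: "coset (supported C) p = coset (supported C) q \<longleftrightarrow> p - q \<in> supported C"
  by (intro coset_eq_iff supported_zero supported_add supported_minus)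

text \<open>Terms with exponent in C vanish in the quotient, so they can be deleted from any
  representative.\<close>

lemma coset_supported_Diff:
  "coset (supported C) ` supported (B - C) = coset (supported C) ` supported B"
proof
  show "coset (supported C) ` supported B \<subseteq> coset (supported C) ` supported (B - C)"
  proof
    fix X assume "X \<in> coset (supported C) ` supported B"
    then obtain p where p: "X = coset (supported C) p" "p \<in> supported B" by auto
    then have "p \<in> supported ((B - C) \<union> C)" by (auto simp: supported_def)
    then obtain q r where "q \<in> supported (B - C)" "r \<in> supported C" "p = r + q"
      by (rule supported_Un_decompose)
    then show "X \<in> coset (supported C) ` supported (B - C)"
      using p by (intro image_eqI[of _ _ q]) (simp_all add: coset_supported_eq_iff)
  qed
qed (simp add: image_mono supported_mono)

lemma coset_add:
  fixes N :: "'a::ab_group_add set"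
  assumes "0 \<in> N" and "\<And>x y. x \<in> N \<Longrightarrow> y \<in> N \<Longrightarrow> x + y \<in> N"
  shows "(\<Union>x\<in>coset N p. \<Union>y\<in>coset N q. {x + y}) = coset N (p + q)"
proof
  show "(\<Union>x\<in>coset N p. \<Union>y\<in>coset N q. {x + y}) \<subseteq> coset N (p + q)"
  proof clarsimp
    fix x y assume "x \<in> coset N p" "y \<in> coset N q"
    then obtain h k where "x = h + p" "y = k + q" "h \<in> N" "k \<in> N" by (auto simp: coset_def)
    then show "x + y \<in> coset N (p + q)"
      unfolding coset_def using assms by (intro image_eqI[of _ _ "h + k"]) simp_all
  qed
  show "coset N (p + q) \<subseteq> (\<Union>x\<in>coset N p. \<Union>y\<in>coset N q. {x + y})"
  proof
    fix z assume "z \<in> coset N (p + q)"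
    then obtain h where h: "z = (h + p) + (0 + q)" "h \<in> N" by (auto simp: coset_def add.assoc)
    then show "z \<in> (\<Union>x\<in>coset N p. \<Union>y\<in>coset N q. {x + y})"
      using assms(1) unfolding coset_def by blast
  qed
qed

text \<open>The union is the way in which \<open>quot_module\<close> defines its scalar
  multiplication. An additive f that preserves N sends all representatives of a coset into one
  coset, so all members of the union agree.\<close>

lemma coset_map:
  fixes N :: "'a::ab_group_add set"
  assumes N: "0 \<in> N" "\<And>x y. x \<in> N \<Longrightarrow> y \<in> N \<Longrightarrow> x + y \<in> N" "\<And>x y. x \<in> N \<Longrightarrow> y \<in> N \<Longrightarrow> x - y \<in> N"
    and f: "\<And>x y. f (x + y) = f x + f y" "\<And>x. x \<in> N \<Longrightarrow> f x \<in> N"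
  shows "(\<Union>x\<in>coset N p. coset N (f x)) = coset N (f p)"
proof -
  have "coset N (f x) = coset N (f p)" if x: "x \<in> coset N p" for x
  proof (rule coset_eq_iff[OF N, THEN iffD2])
    show "f x - f p \<in> N" using x f by (auto simp: coset_def)
  qed
  moreover have "p \<in> coset N p" using N(1) by (force simp: coset_def)
  ultimately show ?thesis by blast
qed

text \<open>Representatives in \<open>supported B\<close> are unique, as a difference of two lies in
  \<open>supported B\<close> and in \<open>supported C\<close>. The operations are given explicitly
  so that the lemma also applies after the carrier has been replaced by a subspace.\<close>

lemma coordinate_space_coset:
  fixes V :: "('k::field, ('n::finite, 'k) mpoly set) module"
  assumes "B \<inter> C = {}" and "carrier V = coset (supported C) ` supported B"
    and "\<zero>\<^bsub>V\<^esub> = supported C"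
    and "\<And>X Y. X \<oplus>\<^bsub>V\<^esub> Y = (\<Union>x\<in>X. \<Union>y\<in>Y. {x + y})"
    and "\<And>c X. c \<odot>\<^bsub>V\<^esub> X = (\<Union>x\<in>X. coset (supported C) (const_poly c * x))"
  shows "coordinate_space V B (coset (supported C))"
proof
  show "coset (supported C) (0 :: ('n, 'k) mpoly) = \<zero>\<^bsub>V\<^esub>"
    by (simp add: assms coset_def)
  show "coset (supported C) (p + q) = coset (supported C) p \<oplus>\<^bsub>V\<^esub> coset (supported C) q" for p q :: "('n, 'k) mpoly"
    by (simp add: assms coset_add supported_add)
  show "coset (supported C) (const_poly c * p) = c \<odot>\<^bsub>V\<^esub> coset (supported C) p" for c and p :: "('n, 'k) mpoly"
    unfolding assms(5)
    by (subst coset_map) (simp_all add: supported_add supported_minus supported_const_poly_mult distrib_left)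
  show "inj_on (coset (supported C)) (supported B :: ('n, 'k) mpoly set)"
  proof (rule inj_onI)
    fix p q :: "('n, 'k) mpoly"
    assume "p \<in> supported B" "q \<in> supported B" "coset (supported C) p = coset (supported C) q"
    then have "p - q = 0"
      using assms(1) by (intro supported_disjoint[of _ B C]) (simp_all add: coset_supported_eq_iff supported_minus)
    then show "p = q" by simp
  qed
qed (fact assms)

lemma basis_family_coset_iff:
  fixes V :: "('k::field, ('n::finite, 'k) mpoly set) module"
  assumes V: "coordinate_space V B (coset (supported C))" and "finite B"
  shows "basis_family V A (\<lambda>a. coset (supported C) (power_product a)) \<longleftrightarrow> A = B"
proof (rule coordinate_space.basis_family_iff[OF assms])
  fix a assume a: "a \<in> A - B" "coset (supported C) (power_product a) \<in> carrier V"
  then obtain q :: "('n, 'k) mpoly"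
    where q: "coset (supported C) (power_product a) = coset (supported C) q" "q \<in> supported B"
    using coordinate_space.carrier_eq[OF V] by auto
  then have "power_product a - q \<in> supported C" by (simp add: coset_supported_eq_iff)
  \<comment> \<open>As a lies outside B, q has no term at a. The difference thus has a term at a,
    and since it lies in \<open>supported C\<close>, a must be in C, which makes the coset
    zero.\<close>
  moreover have "Poly_Mapping.lookup (power_product a - q) a = 1"
    using a supportedD[OF q(2)] by (simp add: lookup_minus power_product_def)
  ultimately have "a \<in> C" using supportedD by fastforce
  then have "coset (supported C) (power_product a) = coset (supported C) (0 :: ('n, 'k) mpoly)"
    by (simp add: coset_supported_eq_iff power_product_mem_supported)
  then show "coset (supported C) (power_product a) = \<zero>\<^bsub>V\<^esub>"
    using coordinate_space.hom_zero[OF V] by simp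
qed

section \<open>Monomial ideals and the apolarity action\<close>

lemma ring_poly_ring: "ring poly_ring"
  by unfold_locales

text \<open>A monomial ideal consists of the polynomials whose exponents are all divisible by the
  exponent of some generator. The right side is an ideal containing the generators, and each term of
  its elements is a multiple of one.\<close>

lemma genideal_power_products:
  "Idl\<^bsub>poly_ring\<^esub> (power_product ` E :: ('n::finite, 'k::field) mpoly set) = supported {\<alpha>. \<exists>\<sigma>\<in>E. \<exists>\<tau>. \<alpha> = \<sigma> + \<tau>}"
    (is "?I = supported ?U")
proof
  have "ideal (supported ?U :: ('n, 'k) mpoly set) poly_ring"
  proof (rule idealI)
    show "subgroup (supported ?U) (add_monoid (poly_ring :: ('n, 'k) mpoly ring))"
    proof (rule group.subgroupI)
      show "group (add_monoid (poly_ring :: ('n, 'k) mpoly ring))"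
        by (rule abelian_group.a_group) unfold_locales
      show "inv\<^bsub>add_monoid poly_ring\<^esub> a \<in> supported ?U" if "a \<in> supported ?U" for a :: "('n, 'k) mpoly"
        using that supported_minus[of 0 ?U a] unfolding a_inv_def[symmetric]
        by (simp add: class_ring_simps)
    qed (auto simp: supported_add intro: supported_zero)
    have single: "\<alpha> + \<beta> \<in> ?U" if \<beta>: "\<beta> \<in> ?U" for \<alpha> \<beta>
    proof -
      obtain \<sigma> \<tau> where \<sigma>: "\<sigma> \<in> E" "\<beta> = \<sigma> + \<tau>" using \<beta> by auto
      then have "\<alpha> + \<beta> = \<sigma> + (\<alpha> + \<tau>)" by (simp only: add.left_commute)
      with \<sigma> show ?thesis by blast
    qed
    have mult: "x * a \<in> supported ?U" if "a \<in> supported ?U" for a x :: "('n, 'k) mpoly"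
      unfolding supported_def
    proof (rule CollectI, rule subsetI)
      fix \<kappa> assume "\<kappa> \<in> Poly_Mapping.keys (x * a)"
      then obtain \<alpha> \<beta> where "\<kappa> = \<alpha> + \<beta>" "\<beta> \<in> Poly_Mapping.keys a"
        using keys_mult[of x a] by blast
      then show "\<kappa> \<in> ?U"
        using that single[of \<beta> \<alpha>] by (simp only: supported_def mem_Collect_eq subset_iff)
    qed
    fix a x :: "('n, 'k) mpoly" assume "a \<in> supported ?U"
    from mult[OF this, of x] show "x \<otimes>\<^bsub>poly_ring\<^esub> a \<in> supported ?U" "a \<otimes>\<^bsub>poly_ring\<^esub> x \<in> supported ?U"
      by (simp_all add: mult.commute[of a x])
  qed (unfold_locales)
  moreover have "power_product ` E \<subseteq> (supported ?U :: ('n, 'k) mpoly set)"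
    unfolding image_subset_iff power_product_mem_supported by (metis (mono_tags) CollectI add_0_right)
  ultimately show "?I \<subseteq> supported ?U"
    by (rule ring.genideal_minimal[OF ring_poly_ring])
  interpret ideal ?I poly_ring
    by (rule ring.genideal_ideal[OF ring_poly_ring]) simp
  show "supported ?U \<subseteq> ?I"
  proof
    fix p :: "('n, 'k) mpoly" assume p: "p \<in> supported ?U"
    show "p \<in> ?I"
    proof (rule mpoly_sum_mem)
      show "0 \<in> ?I" using additive_subgroup.zero_closed[OF is_additive_subgroup] by simp
      show "p + q \<in> ?I" if "p \<in> ?I" "q \<in> ?I" for p q
        using additive_subgroup.a_closed[OF is_additive_subgroup that] by simp
      fix \<alpha> assume "\<alpha> \<in> Poly_Mapping.keys p"
      then obtain \<sigma> \<tau> where \<sigma>: "\<sigma> \<in> E" "\<alpha> = \<sigma> + \<tau>" using p by (auto simp: supported_def)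
      have "(power_product \<sigma> :: ('n, 'k) mpoly) \<in> ?I"
        using ring.genideal_self[OF ring_poly_ring, of "power_product ` E :: ('n, 'k) mpoly set"] \<sigma> by auto
      from I_r_closed[OF this, of "Poly_Mapping.single \<tau> (Poly_Mapping.lookup p \<alpha>)"]
      show "Poly_Mapping.single \<alpha> (Poly_Mapping.lookup p \<alpha>) \<in> ?I"
        by (simp add: \<sigma> power_product_def mult_single)
    qed
  qed
qed

text \<open>In the divided powers \<open>X\<^sup>\<alpha> / weight \<alpha>\<close> the apolarity action is the shift of exponents.\<close>

definition weight :: "('n::finite \<Rightarrow>\<^sub>0 nat) \<Rightarrow> 'k::field_char_0"
  where "weight \<alpha> = (\<Prod>j\<in>UNIV. fact (Poly_Mapping.lookup \<alpha> j))"

lemma weight_nonzero [simp]: "weight \<alpha> \<noteq> 0"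
  by (simp add: weight_def)

lemma lookup_apolar_mono:
  "Poly_Mapping.lookup (apolar_mono \<alpha> \<beta>) \<delta> = (if \<beta> = \<alpha> + \<delta> then weight \<beta> / weight \<delta> else 0)"
proof -
  have "(\<forall>j. Poly_Mapping.lookup \<alpha> j \<le> Poly_Mapping.lookup \<beta> j) \<and> \<beta> - \<alpha> = \<delta> \<longleftrightarrow> \<beta> = \<alpha> + \<delta>"
    by (auto simp: poly_mapping_eq_iff fun_eq_iff lookup_add lookup_minus)
      (metis le_add_diff_inverse)
  then show ?thesis
    by (auto simp: apolar_mono_def weight_def lookup_single)
qed

text \<open>For fixed \<open>\<alpha>\<close> only the term of \<open>\<gamma>\<close> at
  \<open>\<alpha> + \<delta>\<close> can contribute at \<open>\<delta>\<close>, which collapses the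
  inner sum; if that term is absent, its coefficient 0 keeps the formula correct.\<close>

lemma lookup_apolar:
  "Poly_Mapping.lookup (apolar a \<gamma>) \<delta> =
    (\<Sum>\<alpha>\<in>Poly_Mapping.keys a. Poly_Mapping.lookup a \<alpha> *
       (Poly_Mapping.lookup \<gamma> (\<alpha> + \<delta>) * weight (\<alpha> + \<delta>) / weight \<delta>))"
proof -
  have "(\<Sum>\<beta>\<in>Poly_Mapping.keys \<gamma>. Poly_Mapping.lookup
      (const_poly (Poly_Mapping.lookup a \<alpha> * Poly_Mapping.lookup \<gamma> \<beta>) * apolar_mono \<alpha> \<beta>) \<delta>) =
    Poly_Mapping.lookup a \<alpha> * (Poly_Mapping.lookup \<gamma> (\<alpha> + \<delta>) * weight (\<alpha> + \<delta>) / weight \<delta>)" for \<alpha>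
  proof -
    have "(\<Sum>\<beta>\<in>Poly_Mapping.keys \<gamma>. Poly_Mapping.lookup
        (const_poly (Poly_Mapping.lookup a \<alpha> * Poly_Mapping.lookup \<gamma> \<beta>) * apolar_mono \<alpha> \<beta>) \<delta>) =
      (\<Sum>\<beta>\<in>Poly_Mapping.keys \<gamma>. if \<beta> = \<alpha> + \<delta> then Poly_Mapping.lookup a \<alpha> *
         (Poly_Mapping.lookup \<gamma> (\<alpha> + \<delta>) * weight (\<alpha> + \<delta>) / weight \<delta>) else 0)"
      by (intro sum.cong) (simp_all add: lookup_apolar_mono del: const_poly_simps)
    then show ?thesis by (simp add: in_keys_iff)
  qed
  then show ?thesis
    by (simp add: apolar_def lookup_sum)
qed

lemma apolar_add_left: "apolar (a + b) \<gamma> = apolar a \<gamma> + apolar b \<gamma>"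
proof (rule poly_mapping_eqI)
  fix \<delta>
  show "Poly_Mapping.lookup (apolar (a + b) \<gamma>) \<delta> = Poly_Mapping.lookup (apolar a \<gamma> + apolar b \<gamma>) \<delta>"
    unfolding lookup_apolar lookup_add[of "apolar a \<gamma>"]
    \<comment> \<open>Cancellation can make keys of a or b disappear from \<open>a + b\<close>; the
      lost summands add up to zero.\<close>
    by (rule setsum_keys_plus_distrib) (simp_all add: distrib_right add_divide_distrib)
qed

lemma apolar_add_right: "apolar a (\<gamma> + \<gamma>') = apolar a \<gamma> + apolar a \<gamma>'"
  by (rule poly_mapping_eqI)
    (simp only: lookup_add lookup_apolar distrib_left distrib_right add_divide_distrib sum.distrib)

lemma apolar_zero_left [simp]: "apolar 0 \<gamma> = 0"
  by (simp add: apolar_def)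

lemma apolar_zero_right [simp]: "apolar a 0 = 0"
  by (simp add: apolar_def)

lemma lookup_apolar_single:
  "Poly_Mapping.lookup (apolar (Poly_Mapping.single \<alpha> c) \<gamma>) \<delta> =
    c * (Poly_Mapping.lookup \<gamma> (\<alpha> + \<delta>) * weight (\<alpha> + \<delta>) / weight \<delta>)"
  by (simp add: lookup_apolar)

text \<open>Both sides are additive in a and in b, so single terms suffice. For these the two shifts
  of exponents add up, and the intermediate weight cancels.\<close>

lemma apolar_mult: "apolar (a * b) \<gamma> = apolar a (apolar b \<gamma>)"
proof (induction a rule: mpoly_induct)
  case (single \<alpha> c)
  show ?case
  proof (induction b rule: mpoly_induct)
    case (single \<beta> d)
    show ?case
      by (rule poly_mapping_eqI)
        (simp add: mult_single lookup_apolar_single ac_simps)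
  qed (simp_all add: distrib_left apolar_add_left apolar_add_right)
qed (simp_all add: distrib_right apolar_add_left)

lemma apolar_const_poly: "apolar (const_poly c) \<gamma> = const_poly c * \<gamma>"
  by (rule poly_mapping_eqI) (simp add: const_poly_def[of c] lookup_apolar_single, simp add: const_poly_def[symmetric])


section \<open>The maximal ideal and multiplication by single terms\<close>

lemma max_ideal_eq_supported:
  "(max_ideal :: ('n::finite, 'k::field) mpoly set) =
    supported {\<alpha>. \<exists>i \<tau>. \<alpha> = Poly_Mapping.single i 1 + \<tau>}"
proof -
  have "range (var :: 'n \<Rightarrow> ('n, 'k) mpoly) = power_product ` range (\<lambda>i. Poly_Mapping.single i 1)"
    by (auto simp: var_def)
  then show ?thesis
    by (simp only: max_ideal_def genideal_power_products) simp
qed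

lemma var_mem_max_ideal: "var i \<in> max_ideal"
  unfolding max_ideal_eq_supported var_def power_product_mem_supported mem_Collect_eq
  by (intro exI[of _ i] exI[of _ 0]) simp

text \<open>Zero is the only exponent that no variable divides, so removing the constant term leads
  into the maximal ideal.\<close>

lemma diff_const_poly_mem_max_ideal: "a - const_poly (Poly_Mapping.lookup a 0) \<in> max_ideal"
  unfolding max_ideal_eq_supported
proof (rule supportedI)
  fix \<alpha> :: "'a \<Rightarrow>\<^sub>0 nat" assume \<alpha>: "\<alpha> \<notin> {\<alpha>. \<exists>i \<tau>. \<alpha> = Poly_Mapping.single i 1 + \<tau>}"
  have "\<alpha> = 0"
  proof (rule ccontr)
    assume "\<alpha> \<noteq> 0"
    then obtain i where "Poly_Mapping.lookup \<alpha> i \<noteq> 0"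
      by (metis poly_mapping_eqI lookup_zero)
    then have "\<alpha> = Poly_Mapping.single i 1 + (\<alpha> - Poly_Mapping.single i 1)"
      by (auto simp: poly_mapping_eq_iff fun_eq_iff lookup_add lookup_minus lookup_single when_def)
    with \<alpha> show False by blast
  qed
  then show "Poly_Mapping.lookup (a - const_poly (Poly_Mapping.lookup a 0)) \<alpha> = 0"
    by (simp add: lookup_minus const_poly_def)
qed

lemma var_power: "var i ^ n = Poly_Mapping.single (Poly_Mapping.single i n) 1"
  by (induction n) (simp_all add: var_def power_product_def mult_single single_add[symmetric])

lemma lookup_single_mult:
  fixes p :: "('n::finite, 'k::field) mpoly"
  shows "Poly_Mapping.lookup (Poly_Mapping.single \<sigma> c * p) (\<sigma> + \<alpha>) = c * Poly_Mapping.lookup p \<alpha>"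
  by (induction p rule: mpoly_induct)
    (simp_all add: mult_single lookup_single when_def distrib_left lookup_add)

lemma keys_single_mult:
  "Poly_Mapping.keys (Poly_Mapping.single \<sigma> c * p) \<subseteq> (\<lambda>\<alpha>. \<sigma> + \<alpha>) ` Poly_Mapping.keys p"
  using keys_mult[of "Poly_Mapping.single \<sigma> c" p] by (auto split: if_splits)

section \<open>Reduced quotients\<close>

text \<open>Captures both actions at once: multiplication on R and apolarity on the inverse system.
  In each, the constants act as ordinary scalars, and the analysis of reduced quotients is done here
  for both.\<close>

locale poly_module =
  fixes G :: "('n::finite, 'k::field) mpoly set"
    and act :: "('n, 'k) mpoly \<Rightarrow> ('n, 'k) mpoly \<Rightarrow> ('n, 'k) mpoly"
  assumes zero_mem: "0 \<in> G"
    and add_mem: "\<And>p q. p \<in> G \<Longrightarrow> q \<in> G \<Longrightarrow> p + q \<in> G"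
    and act_mem: "\<And>a p. p \<in> G \<Longrightarrow> act a p \<in> G"
    and act_add_left: "\<And>a b p. act (a + b) p = act a p + act b p"
    and act_add_right: "\<And>a p q. act a (p + q) = act a p + act a q"
    and act_mult: "\<And>a b p. act (a * b) p = act a (act b p)"
    and act_const_poly: "\<And>c p. act (const_poly c) p = const_poly c * p"
begin

definition as_module :: "(('n, 'k) mpoly, ('n, 'k) mpoly) module"
  where "as_module =
    \<lparr>carrier = G, mult = undefined, one = undefined, zero = 0, add = (+), smult = act\<rparr>"

lemma as_module_simps [simp]:
  "carrier as_module = G" "\<zero>\<^bsub>as_module\<^esub> = 0" "p \<oplus>\<^bsub>as_module\<^esub> q = p + q" "a \<odot>\<^bsub>as_module\<^esub> p = act a p"
  by (simp_all add: as_module_def)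

lemma act_one: "act 1 p = p"
  using act_const_poly[of 1 p] by simp

lemma act_minus_one: "act (const_poly (- 1)) p = - p"
  by (rule poly_mapping_eqI) (simp add: act_const_poly)

lemma module_as_module: "module poly_ring as_module"
proof (rule module_criteria)
  show "\<forall>v\<in>carrier as_module. \<exists>w\<in>carrier as_module. v \<oplus>\<^bsub>as_module\<^esub> w = \<zero>\<^bsub>as_module\<^esub>"
  proof
    fix v assume "v \<in> carrier as_module"
    then have "- v \<in> G" using act_mem[of v "const_poly (- 1)"] act_minus_one by simp
    then show "\<exists>w\<in>carrier as_module. v \<oplus>\<^bsub>as_module\<^esub> w = \<zero>\<^bsub>as_module\<^esub>"
      by (intro bexI[of _ "- v"]) simp_all
  qed
  show "cring poly_ring" by unfold_locales
qed (simp_all add: zero_mem add_mem act_mem act_add_left act_add_right act_mult act_one add_ac)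

lemma r_coset_eq: "N +>\<^bsub>as_module\<^esub> p = coset N p"
  by (auto simp: a_r_coset_def' coset_def)

lemma quot_module_simps:
  "carrier (quot_module as_module N) = coset N ` G"
  "\<zero>\<^bsub>quot_module as_module N\<^esub> = N"
  "X \<oplus>\<^bsub>quot_module as_module N\<^esub> Y = (\<Union>x\<in>X. \<Union>y\<in>Y. {x + y})"
  "a \<odot>\<^bsub>quot_module as_module N\<^esub> X = (\<Union>x\<in>X. coset N (act a x))"
  by (auto simp: quot_module_def A_RCOSETS_def' r_coset_eq set_add_def')

lemma k_space_quot_module_simps:
  "carrier (k_space (quot_module as_module N)) = coset N ` G"
  "\<zero>\<^bsub>k_space (quot_module as_module N)\<^esub> = N"
  "X \<oplus>\<^bsub>k_space (quot_module as_module N)\<^esub> Y = (\<Union>x\<in>X. \<Union>y\<in>Y. {x + y})"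
  "c \<odot>\<^bsub>k_space (quot_module as_module N)\<^esub> X = (\<Union>x\<in>X. coset N (const_poly c * x))"
  by (simp_all add: k_space_def quot_module_simps act_const_poly)

lemma submoduleI:
  assumes "N \<subseteq> G" "0 \<in> N" "\<And>p q. p \<in> N \<Longrightarrow> q \<in> N \<Longrightarrow> p + q \<in> N" "\<And>a p. p \<in> N \<Longrightarrow> act a p \<in> N"
  shows "LinearCombinations.submodule poly_ring N as_module"
  by (rule LinearCombinations.submodule.intro) (use assms module_as_module in simp_all)

context
  fixes N
  assumes N: "LinearCombinations.submodule poly_ring N as_module"
begin

lemma sub_zero: "0 \<in> N"
  using LinearCombinations.submodule.zero_closed[OF N] by simp

lemma sub_add: "p \<in> N \<Longrightarrow> q \<in> N \<Longrightarrow> p + q \<in> N"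
  using LinearCombinations.submodule.m_closed[OF N] by simp

lemma sub_act: "p \<in> N \<Longrightarrow> act a p \<in> N"
  using LinearCombinations.submodule.smult_closed[OF N] by simp

lemma sub_minus:
  assumes "p \<in> N" "q \<in> N"
  shows "p - q \<in> N"
proof -
  have "- q \<in> N" using sub_act[OF assms(2), of "const_poly (- 1)"] act_minus_one by simp
  from sub_add[OF assms(1) this] show ?thesis by simp
qed

lemma quot_smult: "a \<odot>\<^bsub>quot_module as_module N\<^esub> coset N p = coset N (act a p)"
  unfolding quot_module_simps
  by (rule coset_map) (simp_all add: sub_zero sub_add sub_minus sub_act act_add_right)

lemma coset_eq_self_iff: "coset N p = N \<longleftrightarrow> p \<in> N"
proof -
  have "coset N 0 = N" by (simp add: coset_def)
  then show ?thesis
    using coset_eq_iff[of N p 0] sub_zero sub_add sub_minus by simp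
qed

text \<open>Each term of a has the form r times a variable, and N is closed under the action of
  r.\<close>

lemma act_max_ideal_mem:
  assumes vars: "\<And>i. act (var i) p \<in> N" and a: "a \<in> max_ideal"
  shows "act a p \<in> N"
proof -
  have "a \<in> {a. act a p \<in> N}"
  proof (rule mpoly_sum_mem)
    show "0 \<in> {a. act a p \<in> N}"
      using act_const_poly[of 0 p] sub_zero by simp
    show "x + y \<in> {a. act a p \<in> N}" if "x \<in> {a. act a p \<in> N}" "y \<in> {a. act a p \<in> N}" for x y
      using that by (simp add: act_add_left sub_add)
    fix \<alpha> assume "\<alpha> \<in> Poly_Mapping.keys a"
    then obtain i \<tau> where \<alpha>: "\<alpha> = Poly_Mapping.single i 1 + \<tau>"
      using a by (auto simp: max_ideal_eq_supported supported_def)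
    have "Poly_Mapping.single \<alpha> (Poly_Mapping.lookup a \<alpha>) =
        Poly_Mapping.single \<tau> (Poly_Mapping.lookup a \<alpha>) * var i"
      unfolding var_def power_product_def mult_single \<alpha> by (simp add: add.commute)
    then show "Poly_Mapping.single \<alpha> (Poly_Mapping.lookup a \<alpha>) \<in> {a. act a p \<in> N}"
      using sub_act[OF vars] by (simp add: act_mult)
  qed
  then show ?thesis by simp
qed

text \<open>If the variables kill \<open>p\<close> modulo \<open>N\<close>, then \<open>a\<close> acts on it as its constant term \<open>c\<close>; if \<open>c \<noteq> 0\<close>
  then already \<open>c\<^sup>2p \<in> N\<close> forces \<open>p \<in> N\<close>.\<close>

lemma reduced_element_iff:
  assumes nilpotent: "\<And>i. \<exists>n. act (var i ^ n) p \<in> N"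
  shows "(\<forall>a. act (a ^ 2) p \<in> N \<longrightarrow> act a p \<in> N) \<longleftrightarrow> (\<forall>i. act (var i) p \<in> N)"
proof (intro iffI allI impI)
  fix i assume red: "\<forall>a. act (a ^ 2) p \<in> N \<longrightarrow> act a p \<in> N"
  obtain n where n: "act (var i ^ n) p \<in> N" using nilpotent by blast
  \<comment> \<open>The reducedness condition removes a square, so it halves an exponent that is a
    power of 2, down to 1.\<close>
  have descent: "act (var i ^ (2 ^ k)) p \<in> N \<Longrightarrow> act (var i) p \<in> N" for k
  proof (induction k)
    case (Suc k)
    have "(var i ^ (2 ^ k)) ^ 2 = (var i ^ (2 ^ Suc k) :: ('n, 'k) mpoly)"
      unfolding power_mult[symmetric] by (simp add: mult.commute)
    with Suc red show ?case by metis
  qed simp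
  \<comment> \<open>This raises the nilpotency exponent n to a power of 2, where the descent can
    start.\<close>
  have "n \<le> 2 ^ n" by (simp add: less_imp_le)
  then have "var i ^ (2 ^ n) = var i ^ (2 ^ n - n) * (var i ^ n :: ('n, 'k) mpoly)"
    by (simp add: power_add[symmetric])
  then have "act (var i ^ (2 ^ n)) p \<in> N"
    using sub_act[OF n] by (simp add: act_mult)
  then show "act (var i) p \<in> N" by (rule descent)
next
  fix a assume vars: "\<forall>i. act (var i) p \<in> N" and sq: "act (a ^ 2) p \<in> N"
  define c where "c = Poly_Mapping.lookup a 0"
  define b where "b = a - const_poly c"
  \<comment> \<open>The form keeps y as the right factor of the last summand. With y = b, the
    element b acts on p first and already leads into N, so that only the square of the constant term
    remains.\<close>
  have square_add: "(x + y) ^ 2 = x * x + (x + x + y) * y" for x y :: "('n, 'k) mpoly"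
    unfolding power2_eq_square distrib_left distrib_right by (simp only: mult.commute[of y x] add.assoc)
  have a: "a = const_poly c + b" by (simp add: b_def)
  have b: "act b p \<in> N"
    unfolding b_def c_def
    by (rule act_max_ideal_mem[OF vars[rule_format] diff_const_poly_mem_max_ideal])
  show "act a p \<in> N"
  proof (cases "c = 0")
    case True
    then show ?thesis using b unfolding b_def by simp
  next
    case False
    have "a ^ 2 = const_poly (c * c) + (const_poly c + const_poly c + b) * b"
      unfolding a by (simp only: square_add const_poly_simps)
    then have "act (a ^ 2) p = act (const_poly (c * c)) p + act (const_poly c + const_poly c + b) (act b p)"
      by (simp add: act_add_left act_mult)
    then have "act (const_poly (c * c)) p \<in> N"
      using sub_minus[OF sq sub_act[OF b, of "const_poly c + const_poly c + b"]] by simp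
    from sub_act[OF this, of "const_poly (1 / (c * c))"]
    have "act (const_poly (1 / (c * c) * (c * c))) p \<in> N"
      by (simp only: const_poly_simps act_mult)
    then have "p \<in> N" using False by (simp add: act_one)
    then show ?thesis by (rule sub_act)
  qed
qed

lemma quot_square_smult_eq_zero_iff:
  "(a [^]\<^bsub>poly_ring\<^esub> (2::nat)) \<odot>\<^bsub>quot_module as_module N\<^esub> coset N p = \<zero>\<^bsub>quot_module as_module N\<^esub>
    \<longleftrightarrow> act (a ^ 2) p \<in> N"
  unfolding quot_smult quot_module_simps(2) coset_eq_self_iff class_ring_simps ..

text \<open>\<open>reduced_element_iff\<close> applied to each representative: when the variables
  act nilpotently modulo N, the reduced elements of the quotient form its socle.\<close>

lemma reduced_part_quot_module:
  assumes "\<And>i p. p \<in> G \<Longrightarrow> \<exists>n. act (var i ^ n) p \<in> N"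
  shows "reduced_part poly_ring (quot_module as_module N) = coset N ` {p \<in> G. \<forall>i. act (var i) p \<in> N}"
proof -
  have "coset N p \<in> reduced_part poly_ring (quot_module as_module N) \<longleftrightarrow> (\<forall>i. act (var i) p \<in> N)"
    if "p \<in> G" for p
    unfolding reduced_part_def mem_Collect_eq quot_square_smult_eq_zero_iff
    unfolding quot_smult quot_module_simps(1,2) coset_eq_self_iff reduced_element_iff[OF assms[OF that], symmetric]
    using that by simp
  moreover have "reduced_part poly_ring (quot_module as_module N) \<subseteq> coset N ` G"
    by (auto simp: reduced_part_def quot_module_simps)
  ultimately show ?thesis by blast
qed

lemma reduced_quot_module_iff:
  assumes "\<And>i p. p \<in> G \<Longrightarrow> \<exists>n. act (var i ^ n) p \<in> N"
  shows "reduced_module poly_ring (quot_module as_module N) \<longleftrightarrow> (\<forall>p\<in>G. \<forall>i. act (var i) p \<in> N)"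
proof -
  have "reduced_module poly_ring (quot_module as_module N) \<longleftrightarrow>
      (\<forall>p\<in>G. \<forall>a. act (a ^ 2) p \<in> N \<longrightarrow> act a p \<in> N)"
    unfolding reduced_module_def quot_module_simps(1) ball_simps quot_square_smult_eq_zero_iff
    unfolding quot_smult quot_module_simps(2) coset_eq_self_iff by auto
  then show ?thesis using reduced_element_iff[OF assms] by simp
qed

end

end


interpretation regular: poly_module UNIV "(*) :: ('n::finite, 'k::field) mpoly \<Rightarrow> _"
  rewrites "poly_module.as_module UNIV (*) = (regular_module :: (('n, 'k) mpoly, ('n, 'k) mpoly) module)"
proof -
  show "poly_module UNIV ((*) :: ('n, 'k) mpoly \<Rightarrow> _)"
    by unfold_locales (simp_all add: distrib_left distrib_right mult.assoc)
  from poly_module.as_module_def[OF this]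
  show "poly_module.as_module UNIV (*) = (regular_module :: (('n, 'k) mpoly, ('n, 'k) mpoly) module)"
    by (simp add: regular_module_def)
qed

section \<open>The socle and the inverse system of a monomial ideal\<close>

text \<open>S holds the exponents of the standard monomials of I; \<open>down_closed\<close> says
  that it contains all divisors of its members.\<close>

locale order_ideal =
  fixes I :: "('n::finite, 'k::field_char_0) mpoly set" and S :: "('n \<Rightarrow>\<^sub>0 nat) set"
  assumes I_eq: "I = supported (- S)"
    and down_closed: "\<And>\<alpha> \<tau>. \<alpha> + \<tau> \<in> S \<Longrightarrow> \<alpha> \<in> S"
begin

text \<open>The set T of the overview. Because S is closed under divisors, testing single steps
  \<open>e\<^sub>i\<close> is enough for maximality with respect to divisibility.\<close>

definition maximal_exponents :: "('n \<Rightarrow>\<^sub>0 nat) set"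
  where "maximal_exponents = {\<alpha> \<in> S. \<forall>i. Poly_Mapping.single i 1 + \<alpha> \<notin> S}"

abbreviation exponents_of_degree :: "nat \<Rightarrow> ('n \<Rightarrow>\<^sub>0 nat) set"
  where "exponents_of_degree d \<equiv> {\<alpha>. (\<Sum>i\<in>UNIV. Poly_Mapping.lookup \<alpha> i) = d}"

lemma maximal_exponents_subset: "maximal_exponents \<subseteq> S"
  by (auto simp: maximal_exponents_def)

lemma mod_ideal_eq: "mod_ideal I p = coset (supported (- S)) p"
  by (simp add: mod_ideal_def regular.r_coset_eq I_eq)

lemma submodule_I: "LinearCombinations.submodule poly_ring I regular_module"
proof (rule regular.submoduleI)
  show "a * p \<in> I" if "p \<in> I" for a p
    unfolding I_eq
  proof (rule supportedI)
    fix \<kappa> assume "\<kappa> \<notin> - S"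
    then have "\<kappa> \<in> S" by simp
    have "\<kappa> \<notin> Poly_Mapping.keys (a * p)"
    proof
      assume "\<kappa> \<in> Poly_Mapping.keys (a * p)"
      then obtain \<alpha> \<beta> where "\<kappa> = \<beta> + \<alpha>" "\<beta> \<in> Poly_Mapping.keys p"
        using keys_mult[of a p] add.commute by blast
      then show False
        using that down_closed \<open>\<kappa> \<in> S\<close> unfolding I_eq supported_def by blast
    qed
    then show "Poly_Mapping.lookup (a * p) \<kappa> = 0" by (simp add: in_keys_iff)
  qed
qed (simp_all add: I_eq supported_add)

text \<open>Deleting the terms with exponent outside S from an arbitrary polynomial gives its unique
  representative supported on S.\<close>

lemma coordinate_space_ideal_quotient:
  "coordinate_space (k_space (ideal_quotient I)) S (coset (supported (- S)))"
proof (rule coordinate_space_coset)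
  show "carrier (k_space (ideal_quotient I)) = coset (supported (- S)) ` supported S"
    using coset_supported_Diff[of "- S" UNIV, where 'b = 'k]
    by (simp add: ideal_quotient_def regular.k_space_quot_module_simps I_eq) (simp add: supported_def)
qed (simp_all add: ideal_quotient_def regular.k_space_quot_module_simps I_eq)

lemma finite_exponents:
  assumes "vectorspace.fin_dim (class_ring :: 'k ring) (k_space (ideal_quotient I))"
  shows "finite S"
  using coordinate_space.finite_if_fin_dim[OF coordinate_space_ideal_quotient assms] .

section \<open>The inverse system and its quotient by the action of the maximal ideal\<close>

lemma inverse_system_eq: "inverse_system I = supported S"
proof
  show "inverse_system I \<subseteq> supported S"
  proof
    fix \<gamma> assume \<gamma>: "\<gamma> \<in> inverse_system I"
    show "\<gamma> \<in> supported S"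
    proof (rule supportedI)
      fix \<beta> assume "\<beta> \<notin> S"
      then have "Poly_Mapping.single \<beta> 1 \<in> I" by (simp add: I_eq single_mem_supported)
      then have "apolar (Poly_Mapping.single \<beta> 1) \<gamma> = 0" using \<gamma> by (simp add: inverse_system_def)
      \<comment> \<open>The constant coefficient of this derivative is the coefficient of
        \<open>\<gamma>\<close> at \<open>\<beta>\<close> times the nonzero factor
        \<open>weight \<beta> / weight 0\<close>.\<close>
      then have "Poly_Mapping.lookup (apolar (Poly_Mapping.single \<beta> 1) \<gamma>) 0 = 0" by simp
      then show "Poly_Mapping.lookup \<gamma> \<beta> = 0" by (simp add: lookup_apolar_single)
    qed
  qed
  show "supported S \<subseteq> inverse_system I"
  proof
    fix \<gamma> :: "('n, 'k) mpoly" assume \<gamma>: "\<gamma> \<in> supported S"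
    have "apolar a \<gamma> = 0" if a: "a \<in> I" for a
    proof (rule poly_mapping_eqI)
      fix \<delta>
      have "Poly_Mapping.lookup \<gamma> (\<alpha> + \<delta>) = 0" if "\<alpha> \<in> Poly_Mapping.keys a" for \<alpha>
      proof -
        have "\<alpha> \<notin> S" using that a by (auto simp: I_eq supported_def)
        then show ?thesis using down_closed supportedD[OF \<gamma>] by blast
      qed
      then show "Poly_Mapping.lookup (apolar a \<gamma>) \<delta> = Poly_Mapping.lookup 0 \<delta>"
        by (simp add: lookup_apolar)
    qed
    then show "\<gamma> \<in> inverse_system I" by (simp add: inverse_system_def)
  qed
qed

sublocale dual: poly_module "inverse_system I" apolar
  rewrites "poly_module.as_module (inverse_system I) apolar = inverse_system_module I"
proof -
  show "poly_module (inverse_system I) apolar"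
  proof
    show "apolar a p \<in> inverse_system I" if "p \<in> inverse_system I" for a p
    proof -
      \<comment> \<open>By commutativity of R, b may act on p first, and it annihilates p.\<close>
      have "apolar b (apolar a p) = 0" if "b \<in> I" for b
        using that \<open>p \<in> inverse_system I\<close>
        by (simp add: inverse_system_def apolar_mult[symmetric] mult.commute[of b a])
          (simp add: apolar_mult)
      then show ?thesis by (simp add: inverse_system_def)
    qed
  qed (simp_all add: inverse_system_def apolar_add_left apolar_add_right apolar_mult apolar_const_poly)
  from poly_module.as_module_def[OF this]
  show "poly_module.as_module (inverse_system I) apolar = inverse_system_module I"
    by (simp add: inverse_system_module_def apolar_module_def)
qed

text \<open>A coefficient of the result at \<open>\<delta>\<close> can only come from exponents
  \<open>\<alpha> + \<delta>\<close> of \<open>\<gamma>\<close> with \<open>\<alpha>\<close> a key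
  of a.\<close>

lemma apolar_mem_supported:
  assumes "\<gamma> \<in> supported B"
    and "\<And>\<alpha> \<delta>. \<alpha> \<in> Poly_Mapping.keys a \<Longrightarrow> \<alpha> + \<delta> \<in> B \<Longrightarrow> \<delta> \<in> C"
  shows "apolar a \<gamma> \<in> supported C"
proof (rule supportedI)
  fix \<delta> assume "\<delta> \<notin> C"
  then have "Poly_Mapping.lookup \<gamma> (\<alpha> + \<delta>) = 0" if "\<alpha> \<in> Poly_Mapping.keys a" for \<alpha>
    using assms that supportedD by blast
  then show "Poly_Mapping.lookup (apolar a \<gamma>) \<delta> = 0"
    by (simp add: lookup_apolar)
qed

lemma max_apolar_generators_subset:
  "{apolar a \<gamma> |a \<gamma>. a \<in> max_ideal \<and> \<gamma> \<in> inverse_system I} \<subseteq> inverse_system I"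
  using dual.act_mem by auto

lemma submodule_max_apolar: "LinearCombinations.submodule poly_ring (max_apolar I) (inverse_system_module I)"
  unfolding max_apolar_def
  by (rule module.span_is_submodule[OF dual.module_as_module])
    (simp only: dual.as_module_simps max_apolar_generators_subset)

lemma apolar_mem_max_apolar:
  assumes "a \<in> max_ideal" "\<gamma> \<in> inverse_system I"
  shows "apolar a \<gamma> \<in> max_apolar I"
proof -
  have "{apolar a \<gamma> |a \<gamma>. a \<in> max_ideal \<and> \<gamma> \<in> inverse_system I} \<subseteq> max_apolar I"
    unfolding max_apolar_def
    by (rule module.in_own_span[OF dual.module_as_module])
      (simp only: dual.as_module_simps max_apolar_generators_subset)
  then show ?thesis using assms by blast
qed

lemma max_apolar_subset:
  assumes N: "LinearCombinations.submodule poly_ring N (inverse_system_module I)"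
    and "\<And>a \<gamma>. a \<in> max_ideal \<Longrightarrow> \<gamma> \<in> inverse_system I \<Longrightarrow> apolar a \<gamma> \<in> N"
  shows "max_apolar I \<subseteq> N"
  unfolding max_apolar_def
  by (rule module.span_is_subset[OF dual.module_as_module _ N]) (use assms(2) in blast)

text \<open>Acting by the maximal ideal lowers exponents properly, so only non-maximal ones remain,
  and divisors of non-maximal exponents are non-maximal again. Conversely, a non-maximal
  \<open>\<beta>\<close> is reached from \<open>e\<^sub>i + \<beta>\<close> in S by the i-th
  variable.\<close>

lemma max_apolar_eq: "max_apolar I = supported (S - maximal_exponents)"
proof
  show "max_apolar I \<subseteq> supported (S - maximal_exponents)"
  proof (rule max_apolar_subset)
    show "LinearCombinations.submodule poly_ring (supported (S - maximal_exponents)) (inverse_system_module I)"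
    proof (rule dual.submoduleI)
      show "apolar a p \<in> supported (S - maximal_exponents)" if "p \<in> supported (S - maximal_exponents)" for a p
      proof (rule apolar_mem_supported[OF that])
        fix \<alpha> \<delta> assume *: "\<alpha> + \<delta> \<in> S - maximal_exponents"
        then obtain i where "Poly_Mapping.single i 1 + (\<alpha> + \<delta>) \<in> S"
          by (auto simp: maximal_exponents_def)
        \<comment> \<open>The variable that witnesses non-maximality of
          \<open>\<alpha> + \<delta>\<close> does so for its divisor \<open>\<delta>\<close> as
          well.\<close>
        then have "(Poly_Mapping.single i 1 + \<delta>) + \<alpha> \<in> S" by (simp only: ac_simps)
        then have "Poly_Mapping.single i 1 + \<delta> \<in> S" by (rule down_closed)
        moreover have "\<delta> \<in> S"
          using * down_closed[of \<delta> \<alpha>] by (simp add: add.commute)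
        ultimately show "\<delta> \<in> S - maximal_exponents"
          unfolding maximal_exponents_def by blast
      qed
    qed (simp_all add: supported_add inverse_system_eq supported_mono)
    show "apolar a \<gamma> \<in> supported (S - maximal_exponents)"
      if a: "a \<in> max_ideal" and \<gamma>: "\<gamma> \<in> inverse_system I" for a \<gamma>
    proof (rule apolar_mem_supported)
      show "\<gamma> \<in> supported S" using \<gamma> by (simp add: inverse_system_eq)
      fix \<alpha> \<delta> assume \<alpha>: "\<alpha> \<in> Poly_Mapping.keys a" and \<alpha>\<delta>: "\<alpha> + \<delta> \<in> S"
      then obtain i \<tau> where "\<alpha> = Poly_Mapping.single i 1 + \<tau>"
        using a by (auto simp: max_ideal_eq_supported supported_def)
      then have "(Poly_Mapping.single i 1 + \<delta>) + \<tau> \<in> S" using \<alpha>\<delta> by (simp only: ac_simps)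
      then have "Poly_Mapping.single i 1 + \<delta> \<in> S" by (rule down_closed)
      moreover have "\<delta> \<in> S"
        using \<alpha>\<delta> down_closed[of \<delta> \<alpha>] by (simp add: add.commute)
      ultimately show "\<delta> \<in> S - maximal_exponents"
        unfolding maximal_exponents_def by blast
    qed
  qed
  show "supported (S - maximal_exponents) \<subseteq> max_apolar I"
  proof
    fix p :: "('n, 'k) mpoly" assume p: "p \<in> supported (S - maximal_exponents)"
    show "p \<in> max_apolar I"
    proof (rule mpoly_sum_mem)
      show "0 \<in> max_apolar I" by (rule dual.sub_zero[OF submodule_max_apolar])
      show "x + y \<in> max_apolar I" if "x \<in> max_apolar I" "y \<in> max_apolar I" for x y
        using dual.sub_add[OF submodule_max_apolar that] .
      fix \<beta> assume "\<beta> \<in> Poly_Mapping.keys p"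
      then have "\<beta> \<in> S - maximal_exponents" using p by (auto simp: supported_def)
      then obtain i where i: "Poly_Mapping.single i 1 + \<beta> \<in> S"
        by (auto simp: maximal_exponents_def)
      \<comment> \<open>Chosen to cancel the factor
        \<open>weight (e\<^sub>i + \<beta>) / weight \<beta>\<close> that the i-th variable
        produces.\<close>
      define c where "c = Poly_Mapping.lookup p \<beta> * weight \<beta> / weight (Poly_Mapping.single i 1 + \<beta>)"
      have "apolar (var i) (Poly_Mapping.single (Poly_Mapping.single i 1 + \<beta>) c) =
          Poly_Mapping.single \<beta> (Poly_Mapping.lookup p \<beta>)"
        by (rule poly_mapping_eqI)
          (simp add: var_def power_product_def lookup_apolar_single lookup_single when_def c_def)
      moreover have "apolar (var i) (Poly_Mapping.single (Poly_Mapping.single i 1 + \<beta>) c) \<in> max_apolar I"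
        by (rule apolar_mem_max_apolar[OF var_mem_max_ideal])
          (simp only: inverse_system_eq single_mem_supported i simp_thms)
      ultimately show "Poly_Mapping.single \<beta> (Poly_Mapping.lookup p \<beta>) \<in> max_apolar I" by simp
    qed
  qed
qed

lemma mod_max_apolar_eq: "mod_max_apolar I = coset (supported (S - maximal_exponents))"
  by (rule ext) (simp add: mod_max_apolar_def dual.r_coset_eq max_apolar_eq)

text \<open>Removing the non-maximal exponents from S leaves \<open>maximal_exponents\<close> as the
  exponents of a monomial basis.\<close>

lemma coordinate_space_dual_module:
  "coordinate_space (k_space (dual_module I)) maximal_exponents (coset (supported (S - maximal_exponents)))"
proof (rule coordinate_space_coset)
  have "S - (S - maximal_exponents) = maximal_exponents" using maximal_exponents_subset by blast
  then show "carrier (k_space (dual_module I)) =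
      coset (supported (S - maximal_exponents)) ` supported maximal_exponents"
    using coset_supported_Diff[of "S - maximal_exponents" S, where 'b = 'k]
    by (simp add: dual_module_def dual.k_space_quot_module_simps max_apolar_eq inverse_system_eq)
qed (auto simp add: dual_module_def dual.k_space_quot_module_simps max_apolar_eq)

lemma coordinate_space_dual_grading:
  "coordinate_space ((k_space (dual_module I))\<lparr>carrier := dual_grading I d\<rparr>)
     (maximal_exponents \<inter> exponents_of_degree d) (coset (supported (S - maximal_exponents)))"
proof (rule coordinate_space_coset)
  have "S \<inter> exponents_of_degree d - (S - maximal_exponents) = maximal_exponents \<inter> exponents_of_degree d"
    using maximal_exponents_subset by blast
  then show "carrier ((k_space (dual_module I))\<lparr>carrier := dual_grading I d\<rparr>) =
      coset (supported (S - maximal_exponents)) ` supported (maximal_exponents \<inter> exponents_of_degree d)"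
    using coset_supported_Diff[of "S - maximal_exponents" "S \<inter> exponents_of_degree d", where 'b = 'k]
    by (simp add: dual_grading_def mod_max_apolar_eq inverse_system_eq homogeneous_eq_supported supported_Int)
qed (auto simp add: dual_module_def dual.k_space_quot_module_simps max_apolar_eq)

section \<open>The socle of R/I, described by its representatives\<close>

lemma socle_eq:
  "{p. \<forall>i. var i * p \<in> I} = supported (maximal_exponents \<union> - S)"
proof
  show "{p. \<forall>i. var i * p \<in> I} \<subseteq> supported (maximal_exponents \<union> - S)"
  proof
    fix p assume "p \<in> {p. \<forall>i. var i * p \<in> I}"
    then have p: "var i * p \<in> supported (- S)" for i by (simp add: I_eq)
    show "p \<in> supported (maximal_exponents \<union> - S)"
    proof (rule supportedI)
      fix \<alpha> assume "\<alpha> \<notin> maximal_exponents \<union> - S"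
      then obtain i where "Poly_Mapping.single i 1 + \<alpha> \<notin> - S"
        by (auto simp: maximal_exponents_def)
      \<comment> \<open>The coefficient of p at \<open>\<alpha>\<close> reappears in
        \<open>var i * p\<close> at \<open>e\<^sub>i + \<alpha>\<close>, an exponent in S, where
        that product has none.\<close>
      from supportedD[OF p[of i] this] show "Poly_Mapping.lookup p \<alpha> = 0"
        by (simp only: var_def power_product_def lookup_single_mult mult_1)
    qed
  qed
  show "supported (maximal_exponents \<union> - S) \<subseteq> {p. \<forall>i. var i * p \<in> I}"
  proof (intro subsetI CollectI allI)
    fix p :: "('n, 'k) mpoly" and i assume p: "p \<in> supported (maximal_exponents \<union> - S)"
    have "Poly_Mapping.single i 1 + \<alpha> \<in> - S" if "\<alpha> \<in> Poly_Mapping.keys p" for \<alpha>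
    proof
      assume "Poly_Mapping.single i 1 + \<alpha> \<in> S"
      then have "\<alpha> \<in> S" "\<alpha> \<notin> maximal_exponents"
        using down_closed[of \<alpha> "Poly_Mapping.single i 1"]
        by (simp_all only: add.commute) (auto simp: maximal_exponents_def add.commute)
      then show False using p that by (auto simp: supported_def)
    qed
    then show "var i * p \<in> I"
      using keys_single_mult[of "Poly_Mapping.single i 1" 1 p]
      unfolding I_eq supported_def var_def power_product_def by blast
  qed
qed

section \<open>Consequences of finite dimension: nilpotent variables, bases and Hilbert
  series\<close>

context
  assumes finite_S: "finite S"
begin

text \<open>Take n larger than every i-th entry of the finitely many exponents in S. The n-th power
  of the i-th variable then annihilates both R/I and the inverse system.\<close>

lemma exponent_bound:
  obtains n where "\<And>\<alpha>. Poly_Mapping.single i n + \<alpha> \<notin> S"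
proof -
  have "finite ((\<lambda>\<alpha>. Poly_Mapping.lookup \<alpha> i) ` S)" using finite_S by simp
  then obtain n where n: "\<forall>m\<in>(\<lambda>\<alpha>. Poly_Mapping.lookup \<alpha> i) ` S. m < n"
    unfolding finite_nat_set_iff_bounded by blast
  have "Poly_Mapping.single i n + \<alpha> \<notin> S" for \<alpha>
  proof
    assume "Poly_Mapping.single i n + \<alpha> \<in> S"
    with n have "Poly_Mapping.lookup (Poly_Mapping.single i n + \<alpha>) i < n" by blast
    then show False by (simp add: lookup_add)
  qed
  then show ?thesis by (rule that)
qed

lemma var_power_mult_mem: "\<exists>n. var i ^ n * p \<in> I"
proof -
  obtain n where "\<And>\<alpha>. Poly_Mapping.single i n + \<alpha> \<notin> S" using exponent_bound by blast
  then have "var i ^ n * p \<in> I"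
    using keys_single_mult[of "Poly_Mapping.single i n" 1 p]
    unfolding I_eq supported_def var_power by blast
  then show ?thesis ..
qed

lemma var_power_apolar_eq_zero:
  assumes "\<gamma> \<in> inverse_system I"
  shows "\<exists>n. apolar (var i ^ n) \<gamma> = 0"
proof -
  obtain n where n: "\<And>\<alpha>. Poly_Mapping.single i n + \<alpha> \<notin> S" using exponent_bound by blast
  have "apolar (var i ^ n) \<gamma> = 0"
    by (rule poly_mapping_eqI)
      (use n assms in \<open>simp add: var_power lookup_apolar_single inverse_system_eq supportedD\<close>)
  then show ?thesis ..
qed

lemma reduced_quotient_part_eq:
  "reduced_quotient_part I = coset (supported (- S)) ` supported maximal_exponents"
proof -
  have "reduced_quotient_part I = coset (supported (- S)) ` supported (maximal_exponents \<union> - S)"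
    unfolding reduced_quotient_part_def ideal_quotient_def
    using regular.reduced_part_quot_module[OF submodule_I var_power_mult_mem]
    by (simp add: socle_eq I_eq[symmetric])
  moreover have "(maximal_exponents \<union> - S) - (- S) = maximal_exponents"
    using maximal_exponents_subset by blast
  ultimately show ?thesis
    using coset_supported_Diff[of "- S" "maximal_exponents \<union> - S", where 'b = 'k]
    by simp
qed

lemma coordinate_space_reduced_part:
  "coordinate_space (reduced_part_space I) maximal_exponents (coset (supported (- S)))"
  by (rule coordinate_space_coset)
    (use maximal_exponents_subset in \<open>auto simp: reduced_part_space_def reduced_quotient_part_eq
       ideal_quotient_def regular.k_space_quot_module_simps I_eq[symmetric]\<close>)

text \<open>A reduced class of degree d has a representative p supported on maximal exponents and a
  homogeneous representative q. They agree on S, because their difference lies in I; hence p is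
  itself homogeneous of degree d.\<close>

lemma reduced_part_grading_eq:
  "reduced_part_grading I d =
    coset (supported (- S)) ` supported (maximal_exponents \<inter> exponents_of_degree d)"
proof -
  have "X \<in> coset (supported (- S)) ` supported (maximal_exponents \<inter> exponents_of_degree d)"
    if "X \<in> reduced_part_grading I d" for X :: "('n, 'k) mpoly set"
  proof -
    have "X \<in> coset (supported (- S)) ` supported maximal_exponents"
      and "X \<in> coset (supported (- S)) ` supported (exponents_of_degree d)"
      using that by (simp_all add: reduced_part_grading_def reduced_quotient_part_eq mod_ideal_eq
          homogeneous_eq_supported)
    then obtain p q where p: "X = coset (supported (- S)) p" "p \<in> supported maximal_exponents"
      and q: "X = coset (supported (- S)) q" "q \<in> supported (exponents_of_degree d)"
      by blast
    have pq: "p - q \<in> supported (- S)"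
      using p q by (simp add: coset_supported_eq_iff[symmetric])
    have "p \<in> supported (maximal_exponents \<inter> exponents_of_degree d)"
    proof (rule supportedI)
      fix \<alpha> assume \<alpha>: "\<alpha> \<notin> maximal_exponents \<inter> exponents_of_degree d"
      show "Poly_Mapping.lookup p \<alpha> = 0"
      proof (cases "\<alpha> \<in> maximal_exponents")
        case True
        then have "Poly_Mapping.lookup (p - q) \<alpha> = 0" "Poly_Mapping.lookup q \<alpha> = 0"
          using maximal_exponents_subset \<alpha> by (auto intro!: supportedD[OF pq] supportedD[OF q(2)])
        then show ?thesis by (simp add: lookup_minus)
      next
        case False
        then show ?thesis using supportedD[OF p(2)] by blast
      qed
    qed
    then show ?thesis using p by blast
  qed
  moreover have "X \<in> reduced_part_grading I d"
    if "X \<in> coset (supported (- S)) ` supported (maximal_exponents \<inter> exponents_of_degree d)" for X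
    using that by (auto simp: reduced_part_grading_def reduced_quotient_part_eq mod_ideal_eq
        homogeneous_eq_supported supported_Int[symmetric])
  ultimately show ?thesis by blast
qed

lemma coordinate_space_reduced_part_grading:
  "coordinate_space ((reduced_part_space I)\<lparr>carrier := reduced_part_grading I d\<rparr>)
     (maximal_exponents \<inter> exponents_of_degree d) (coset (supported (- S)))"
  by (rule coordinate_space_coset)
    (use maximal_exponents_subset in \<open>auto simp: reduced_part_space_def reduced_part_grading_eq
       ideal_quotient_def regular.k_space_quot_module_simps I_eq[symmetric]\<close>)

lemma finite_maximal_exponents: "finite maximal_exponents"
  using finite_S maximal_exponents_subset by (rule finite_subset[rotated])

text \<open>In each degree both dimensions count the maximal exponents of that degree.\<close>

lemma hilbert_series_eq:
  "hilbert_series (reduced_part_space I) (reduced_part_grading I) =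
    hilbert_series (k_space (dual_module I)) (dual_grading I)"
  unfolding hilbert_series_def
  using finite_maximal_exponents
    coordinate_space.dim_eq_card[OF coordinate_space_reduced_part_grading]
    coordinate_space.dim_eq_card[OF coordinate_space_dual_grading]
  by simp

text \<open>Some power of each variable annihilates a given element of the inverse system, so it
  maps the element into every submodule N.\<close>

lemma reduced_quotient_iff:
  assumes N: "LinearCombinations.submodule poly_ring N (inverse_system_module I)"
  shows "reduced_module poly_ring (quot_module (inverse_system_module I) N) \<longleftrightarrow>
    (\<forall>\<gamma>\<in>inverse_system I. \<forall>i. apolar (var i) \<gamma> \<in> N)"
proof (rule dual.reduced_quot_module_iff[OF N])
  show "\<exists>n. apolar (var i ^ n) p \<in> N" if "p \<in> inverse_system I" for i p
    using var_power_apolar_eq_zero[OF that, of i] dual.sub_zero[OF N] by metis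
qed

lemma reduced_dual_module: "reduced_module poly_ring (dual_module I)"
  unfolding dual_module_def reduced_quotient_iff[OF submodule_max_apolar]
  using apolar_mem_max_apolar var_mem_max_ideal by blast

text \<open>Reducedness puts the action of the variables into N; these generate the maximal ideal,
  and \<open>max_apolar I\<close> is the least submodule containing its action.\<close>

lemma max_apolar_subset_if_reduced:
  assumes N: "LinearCombinations.submodule poly_ring N (inverse_system_module I)"
    and "reduced_module poly_ring (quot_module (inverse_system_module I) N)"
  shows "max_apolar I \<subseteq> N"
proof (rule max_apolar_subset[OF N])
  fix a \<gamma> :: "('n, 'k) mpoly" assume a: "a \<in> max_ideal" and \<gamma>: "\<gamma> \<in> inverse_system I"
  have "apolar (var i) \<gamma> \<in> N" for i
    using assms(2)[unfolded reduced_quotient_iff[OF N]] \<gamma> by blast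
  then show "apolar a \<gamma> \<in> N"
    using a by (rule dual.act_max_ideal_mem[OF N])
qed

lemma basis_family_reduced_part_iff:
  "basis_family (reduced_part_space I) A (\<lambda>a. mod_ideal I (power_product a)) \<longleftrightarrow> A = maximal_exponents"
  unfolding mod_ideal_eq
  by (rule basis_family_coset_iff[OF coordinate_space_reduced_part finite_maximal_exponents])

lemma basis_family_dual_module_iff:
  "basis_family (k_space (dual_module I)) A (\<lambda>a. mod_max_apolar I (power_product a)) \<longleftrightarrow>
    A = maximal_exponents"
  unfolding mod_max_apolar_eq
  by (rule basis_family_coset_iff[OF coordinate_space_dual_module finite_maximal_exponents])

end

end

section \<open>From a monomial ideal to its standard exponents, and the three assertions\<close>

lemma monomial_ideal_order_ideal:
  fixes I :: "('n::finite, 'k::field_char_0) mpoly set"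
  assumes "monomial_ideal I"
  obtains S where "order_ideal I S"
proof -
  obtain E where E: "I = Idl\<^bsub>poly_ring\<^esub> (power_product ` E)"
    using assms by (auto simp: monomial_ideal_def)
  have "order_ideal I (- {\<alpha>. \<exists>\<sigma>\<in>E. \<exists>\<tau>. \<alpha> = \<sigma> + \<tau>})"
    by unfold_locales (auto simp: E genideal_power_products add.assoc)
  then show ?thesis by (rule that)
qed

theorem theorem3p2:
  fixes I :: "('n::finite, 'k::{alg_closed_field, field_char_0}) mpoly set"
  assumes "monomial_ideal I"
    and "vectorspace.fin_dim (class_ring :: 'k ring) (k_space (ideal_quotient I))"
  shows
    "(\<forall>A :: ('n \<Rightarrow>\<^sub>0 nat) set.
        basis_family (reduced_part_space I) A (\<lambda>a. mod_ideal I (power_product a)) \<longleftrightarrow>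
        (\<forall>a\<in>A. power_product a \<in> inverse_system I) \<and>
        basis_family (k_space (dual_module I)) A (\<lambda>a. mod_max_apolar I (power_product a))) \<and>
     hilbert_series (reduced_part_space I) (reduced_part_grading I) =
       hilbert_series (k_space (dual_module I)) (dual_grading I) \<and>
     reduced_module poly_ring (dual_module I) \<and>
     (\<forall>N. LinearCombinations.submodule poly_ring N (inverse_system_module I) \<and>
        reduced_module poly_ring (quot_module (inverse_system_module I) N) \<longrightarrow>
        max_apolar I \<subseteq> N)"
proof -
  obtain S where "order_ideal I S"
    using monomial_ideal_order_ideal[OF assms(1)] .
  then interpret order_ideal I S .
  note finite_S = finite_exponents[OF assms(2)]
  \<comment> \<open>Both basis conditions say that A equals \<open>maximal_exponents\<close>; this
    adds the membership in the inverse system for that A.\<close>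
  have "\<forall>a\<in>maximal_exponents. power_product a \<in> inverse_system I"
    using maximal_exponents_subset by (auto simp: inverse_system_eq power_product_mem_supported)
  then have "\<forall>A. basis_family (reduced_part_space I) A (\<lambda>a. mod_ideal I (power_product a)) \<longleftrightarrow>
      (\<forall>a\<in>A. power_product a \<in> inverse_system I) \<and>
      basis_family (k_space (dual_module I)) A (\<lambda>a. mod_max_apolar I (power_product a))"
    unfolding basis_family_reduced_part_iff[OF finite_S] basis_family_dual_module_iff[OF finite_S]
    by blast
  then show ?thesis
    using hilbert_series_eq[OF finite_S] reduced_dual_module[OF finite_S]
      max_apolar_subset_if_reduced[OF finite_S] by blast
qed

end
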